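(* Let $\mathcal{G}_{\rm dist}$ be the distributed game described in the context. Suppose that for all $i\in I_N$ and $t\in[0,T]$ the map $\mathbb{R}^{n_x}\times\mathbb{R}^{n_a}\ni(x,a)\mapsto(f_i(t,x,a),g_i(x))\in\mathbb{R}^2$ is twice continuously differentiable, that for all $i,j\in I_N$, $$\begin{pmatrix}\partial_{x_ix_j}f_i&\partial_{a_ix_j}f_i\\ \partial_{x_ia_j}f_i&\partial_{a_ia_j}f_i\end{pmatrix}=\begin{pmatrix}\partial_{x_ix_j}f_j&\partial_{a_ix_j}f_j\\ \partial_{x_ia_j}f_j&\partial_{a_ia_j}f_j\end{pmatrix},\qquad \partial_{x_ix_j}g_i=\partial_{x_ix_j}g_j,$$ and that for all $i\in I_N$, $$\sup_{(t,x,a)\in[0,T]\times\mathbb{R}^{n_x}\times\mathbb{R}^{n_a}}\frac{|(\partial_{(x_i,a_i)}f_i)(t,x,a)|+|(\partial_{x_i}g_i)(x)|}{1+|x|+|a|}<\infty.$$ Then $\mathcal{G}_{\rm dist}$ is a Markov potential game and a potential function is given by $$\Phi^{t,x}(\phi)=\mathbb{E}^{\mathbb{P}}\left[\int_t^TF(s,X_s^{t,x,\phi},\alpha_s^{t,x,\phi})\,\mathrm{d}s+G(X_T^{t,x,\phi})\right],$$ where, for some fixed $(\hat x,\hat a)\in\mathbb{R}^{n_x}\times\mathbb{R}^{n_a}$, $$F(t,x,a):=\sum_{i=1}^N\int_0^1\left(\begin{pmatrix}\partial_{x_i}f_i\\ \partial_{a_i}f_i\end{pmatrix}\big(t,\hat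 x+r(x-\hat x),\hat a+r(a-\hat a)\big)\right)^\top\begin{pmatrix}x_i-\hat x_i\\ a_i-\hat a_i\end{pmatrix}\mathrm{d}r,$$ $$G(x):=\sum_{i=1}^N\int_0^1(\partial_{x_i}g_i)(\hat x+r(x-\hat x))^\top(x_i-\hat x_i)\,\mathrm{d}r.$$
   Context: Distributed game $\mathcal{G}_{\rm dist}$. Let $T>0$, $N\in\mathbb{N}$, $(n_i)_{i=1}^N,(k_i)_{i=1}^N\subset\mathbb{N}$, $I_N=\{1,\dots,N\}$, $\mathcal{S}=[0,T]\times\prod_{i\in I_N}\mathbb{R}^{n_i}$, $A_i$ a Borel set in $\mathbb{R}^{k_i}$, $n_x=\sum_i n_i$, $n_a=\sum_i k_i$. Let $W$ be an $n_w$-dimensional Brownian motion on a probability space $(\Omega,\mathcal{F},\mathbb{P})$ and let $(b_i,\sigma_i):[0,T]\times\mathbb{R}^{n_i}\times\mathbb{R}^{k_i}\to\mathbb{R}^{n_i}\times\mathbb{R}^{n_i\times n_w}$ be measurable. The set of policy profiles is $\pi^{(N)}_{\rm dist}=\prod_{i\in I_N}\pi_i^{\rm dist}$, where $\pi_i^{\rm dist}$ contains measurable functions $\phi_i:[0,T]\times\mathbb{R}^{n_i}\to A_i$ such that $\sup_{(t,x_i)}\frac{|\phi_i(t,x_i)|}{1+|x_i|}<\infty$ and for all $(t,x_i)\in[0,T]\times\mathbb{R}^{n_i}$ player $i$'s state dynamics $$\mathrm{d}X_s^i=b_i(s,X_s^i,\phi_i(s,X_s^i))\,\mathrm{d}s+\sigma_i(s,X_s^i,\phi_i(s,X_s^i))\,\mathrm{d}W_s,\quad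 s\in[t,T];\qquad X_t^i=x_i,$$ admits a unique square-integrable weak solution $X^{t,x_i,\phi_i}$ on the probability space $(\Omega,\mathcal{F},\mathbb{P})$ (the same space for all players). For $t\in[0,T]$, $x=(x_i)_{i\in I_N}\in\prod_i\mathbb{R}^{n_i}$ and $\phi=(\phi_i)_{i\in I_N}\in\pi^{(N)}_{\rm dist}$, let $X^{t,x,\phi}=(X^{t,x_i,\phi_i})_{i\in I_N}$ and $\alpha^{t,x,\phi}=(\phi_i(\cdot,X^{t,x_i,\phi_i}))_{i\in I_N}$. Player $i$'s value function $V_i:[0,T]\times\mathbb{R}^{n_x}\times\pi^{(N)}_{\rm dist}\to\mathbb{R}$ is $$V_i^{t,x}(\phi)=\mathbb{E}^{\mathbb{P}}\left[\int_t^Tf_i(s,X_s^{t,x,\phi},\alpha_s^{t,x,\phi})\,\mathrm{d}s+g_i(X_T^{t,x,\phi})\right],$$ where $f_i:[0,T]\times\mathbb{R}^{n_x}\times\mathbb{R}^{n_a}\to\mathbb{R}$ is measurable with $\sup_{(t,x,a)}\frac{|f_i(t,x,a)|}{1+|x|^2+|a|^2}<\infty$ and $g_i:\mathbb{R}^{n_x}\to\mathbb{R}$ is measurable with $\sup_x\frac{|g_i(x)|}{1+|x|^2}<\infty$. Here $x=(x_i)_{i\in I_N}$ with $x_i\in\mathbb{R}^{n_i}$ and $a=(a_i)_{i\in I_N}$ with $a_i\in\mathbb{R}^{k_i}$. Markov potential game. $\mathcal{G}_{\rm dist}$ is a Markov potential game with potential function $\Phi:[0,T]\times\mathbb{R}^{n_x}\times\pi^{(N)}_{\rm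 dist}\to\mathbb{R}$ if for all $(t,x)$, all $i\in I_N$, all $\phi_i,\phi_i'\in\pi_i^{\rm dist}$ and all $\phi_{-i}=(\phi_j)_{j\ne i}\in\prod_{j\ne i}\pi_j^{\rm dist}$, $\Phi^{t,x}((\phi_i',\phi_{-i}))-\Phi^{t,x}((\phi_i,\phi_{-i}))=V_i^{t,x}((\phi_i',\phi_{-i}))-V_i^{t,x}((\phi_i,\phi_{-i}))$, where $\Phi^{t,x}(\phi)=\Phi(t,x,\phi)$. *)

theory Defs
  imports "HOL-Probability.Probability"
begin

section \<open>Brownian motion and stochastic integrals\<close>

definition tends_to_0_in_probability ::
    "'w measure \<Rightarrow> (nat \<Rightarrow> 'w \<Rightarrow> ennreal) \<Rightarrow> bool" where
  "tends_to_0_in_probability M Y \<longleftrightarrow>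
     (\<forall>m. Y m \<in> borel_measurable M) \<and>
     (\<forall>\<epsilon>>0. (\<lambda>m. measure M {\<omega> \<in> space M. \<epsilon> \<le> Y m \<omega>}) \<longlonglongrightarrow> 0)"

text \<open>\<open>W\<close> is a Brownian motion on \<open>[0,T]\<close> relative to the filtration \<open>\<F>\<close>: the increments
  \<open>W\<^sub>u - W\<^sub>s\<close> are independent of \<open>\<F>\<^sub>s\<close> and centred Gaussian with covariance \<open>(u - s) I\<close>.\<close>

definition brownian_motion_wrt ::
    "'w measure \<Rightarrow> (real \<Rightarrow> 'w measure) \<Rightarrow> real \<Rightarrow> (real \<Rightarrow> 'w \<Rightarrow> real ^ 'm::finite) \<Rightarrow> bool" where
  "brownian_motion_wrt M \<F> T W \<longleftrightarrow>
     filtration (space M) \<F> \<and> (\<forall>s. subalgebra M (\<F> s)) \<and>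
     (\<forall>s\<in>{0..T}. W s \<in> borel_measurable (\<F> s)) \<and>
     (AE \<omega> in M. W 0 \<omega> = 0) \<and>
     (AE \<omega> in M. continuous_on {0..T} (\<lambda>s. W s \<omega>)) \<and>
     (\<forall>s u. 0 \<le> s \<and> s < u \<and> u \<le> T \<longrightarrow>
        prob_space.indep_set M (sets (\<F> s))
          (sets (vimage_algebra (space M) (\<lambda>\<omega>. W u \<omega> - W s \<omega>) borel)) \<and>
        distributed M lborel (\<lambda>\<omega>. W u \<omega> - W s \<omega>)
          (\<lambda>z. ennreal (\<Prod>k\<in>UNIV. normal_density 0 (sqrt (u - s)) (z $ k))))"

definition natural_filtration ::
    "'w measure \<Rightarrow> real \<Rightarrow> (real \<Rightarrow> 'w \<Rightarrow> real ^ 'm::finite) \<Rightarrow> real \<Rightarrow> 'w measure" where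
  "natural_filtration M T W s =
     sigma (space M) {W u -` B \<inter> space M | u B. u \<in> {0..min s T} \<and> B \<in> sets borel}"

definition brownian_motion :: "'w measure \<Rightarrow> real \<Rightarrow> (real \<Rightarrow> 'w \<Rightarrow> real ^ 'm::finite) \<Rightarrow> bool" where
  "brownian_motion M T W \<longleftrightarrow> brownian_motion_wrt M (natural_filtration M T W) T W"

text \<open>Elementary integrands on \<open>(t,T]\<close>: \<open>\<Sum>k<n. \<xi>\<^sub>k 1\<^bsub>(\<tau>\<^sub>k, \<tau>\<^sub>k\<^sub>+\<^sub>1]\<^esub>\<close>, with deterministic times and
  bounded \<open>\<F>\<^bsub>\<tau>\<^sub>k\<^esub>\<close>-measurable matrix coefficients.\<close>

definition simple_integrand ::
    "'w measure \<Rightarrow> (real \<Rightarrow> 'w measure) \<Rightarrow> real \<Rightarrow> real \<Rightarrow> nat \<Rightarrow> (nat \<Rightarrow> real) \<Rightarrow>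
     (nat \<Rightarrow> 'w \<Rightarrow> real ^ 'm::finite ^ 'd::finite) \<Rightarrow> bool" where
  "simple_integrand M \<F> t T n \<tau> \<xi> \<longleftrightarrow>
     mono_on {..n} \<tau> \<and> \<tau> ` {..n} \<subseteq> {t..T} \<and>
     (\<forall>k<n. \<xi> k \<in> borel_measurable (\<F> (\<tau> k)) \<and> bounded (\<xi> k ` space M))"

definition simple_process ::
    "nat \<Rightarrow> (nat \<Rightarrow> real) \<Rightarrow> (nat \<Rightarrow> 'w \<Rightarrow> real ^ 'm::finite ^ 'd::finite) \<Rightarrow>
     real \<Rightarrow> 'w \<Rightarrow> real ^ 'm ^ 'd" where
  "simple_process n \<tau> \<xi> s \<omega> = (\<Sum>k<n. indicat_real {\<tau> k<..\<tau> (Suc k)} s *\<^sub>R \<xi> k \<omega>)"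

definition simple_stochastic_integral ::
    "(real \<Rightarrow> 'w \<Rightarrow> real ^ 'm::finite) \<Rightarrow> nat \<Rightarrow> (nat \<Rightarrow> real) \<Rightarrow>
     (nat \<Rightarrow> 'w \<Rightarrow> real ^ 'm ^ 'd::finite) \<Rightarrow> real \<Rightarrow> 'w \<Rightarrow> real ^ 'd" where
  "simple_stochastic_integral W n \<tau> \<xi> s \<omega> =
     (\<Sum>k<n. \<xi> k \<omega> *v (W (min s (\<tau> (Suc k))) \<omega> - W (min s (\<tau> k)) \<omega>))"

definition progressively_measurable ::
    "(real \<Rightarrow> 'w measure) \<Rightarrow> real \<Rightarrow> real \<Rightarrow> (real \<Rightarrow> 'w \<Rightarrow> 'a::topological_space) \<Rightarrow> bool" where
  "progressively_measurable \<F> t T H \<longleftrightarrow>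
     (\<forall>s\<in>{t..T}. (\<lambda>(u, \<omega>). H u \<omega>)
        \<in> borel_measurable (restrict_space borel {t..s} \<Otimes>\<^sub>M \<F> s))"

text \<open>\<open>I\<^sub>s = \<integral>\<^sub>t\<^sup>s H dW\<close> for \<open>s \<in> [t,T]\<close> is the Ito integral of a progressively measurable \<open>H\<close> with
  \<open>\<integral>\<^sub>t\<^sup>T |H|\<^sup>2 ds < \<infinity>\<close> almost surely: the continuous process which is the limit in probability of the
  integrals of elementary integrands \<open>H\<^sub>m\<close> with \<open>\<integral>\<^sub>t\<^sup>T |H - H\<^sub>m|\<^sup>2 ds \<rightarrow> 0\<close> in probability. This
  determines \<open>I\<close> up to indistinguishability. The norm of a matrix is the Frobenius norm.\<close>

definition is_stochastic_integral ::
    "'w measure \<Rightarrow> (real \<Rightarrow> 'w measure) \<Rightarrow> (real \<Rightarrow> 'w \<Rightarrow> real ^ 'm::finite) \<Rightarrow> real \<Rightarrow> real \<Rightarrow>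
     (real \<Rightarrow> 'w \<Rightarrow> real ^ 'm ^ 'd::finite) \<Rightarrow> (real \<Rightarrow> 'w \<Rightarrow> real ^ 'd) \<Rightarrow> bool" where
  "is_stochastic_integral M \<F> W t T H I \<longleftrightarrow>
     progressively_measurable \<F> t T H \<and>
     (AE \<omega> in M. (\<integral>\<^sup>+ s\<in>{t..T}. ennreal ((norm (H s \<omega>))\<^sup>2) \<partial>lborel) < \<infinity>) \<and>
     (\<forall>s\<in>{t..T}. I s \<in> borel_measurable M) \<and>
     (AE \<omega> in M. continuous_on {t..T} (\<lambda>s. I s \<omega>)) \<and>
     (\<exists>n \<tau> \<xi>.
        (\<forall>m. simple_integrand M \<F> t T (n m) (\<tau> m) (\<xi> m)) \<and>
        tends_to_0_in_probability M
          (\<lambda>m \<omega>. \<integral>\<^sup>+ s\<in>{t..T}.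
             ennreal ((norm (H s \<omega> - simple_process (n m) (\<tau> m) (\<xi> m) s \<omega>))\<^sup>2) \<partial>lborel) \<and>
        (\<forall>s\<in>{t..T}. tends_to_0_in_probability M
          (\<lambda>m \<omega>. ennreal (norm (I s \<omega> -
             simple_stochastic_integral W (n m) (\<tau> m) (\<xi> m) s \<omega>)))))"

section \<open>Partial derivatives and \<open>C\<^sup>2\<close> maps\<close>

definition twice_continuously_differentiable ::
    "('a::real_normed_vector \<Rightarrow> 'b::real_normed_vector) \<Rightarrow> bool" where
  "twice_continuously_differentiable h \<longleftrightarrow>
     (\<exists>(h' :: 'a \<Rightarrow> 'a \<Rightarrow>\<^sub>L 'b) (h'' :: 'a \<Rightarrow> 'a \<Rightarrow>\<^sub>L ('a \<Rightarrow>\<^sub>L 'b)).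
        (\<forall>p. (h has_derivative blinfun_apply (h' p)) (at p)) \<and>
        (\<forall>p. (h' has_derivative blinfun_apply (h'' p)) (at p)) \<and>
        continuous_on UNIV h'')"

definition partial_deriv :: "'a::real_normed_vector \<Rightarrow> ('a \<Rightarrow> real) \<Rightarrow> 'a \<Rightarrow> real" where
  "partial_deriv e h p = deriv (\<lambda>r. h (p + r *\<^sub>R e)) 0"

text \<open>Vectors in \<open>\<Prod>\<^sub>i \<real>\<^bsup>n\<^sub>i\<^esup>\<close> with \<open>n\<^sub>i\<close> depending on the player \<open>i\<close> are encoded as follows. A finite type
  \<open>'d\<close> labels all \<open>\<Sum>\<^sub>i n\<^sub>i\<close> coordinates, and \<open>own k\<close> is the player to whom coordinate \<open>k\<close> belongs, so
  that \<open>n\<^sub>i\<close> is the number of \<open>k\<close> with \<open>own k = i\<close>. Then \<open>\<Prod>\<^sub>i \<real>\<^bsup>n\<^sub>i\<^esup>\<close> is the type \<open>real ^ 'd\<close>, and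
  \<open>\<real>\<^bsup>n\<^sub>i\<^esup>\<close> is its subspace \<open>block own i\<close> of vectors supported on the coordinates of player \<open>i\<close>.\<close>

definition block :: "('d::finite \<Rightarrow> 'p) \<Rightarrow> 'p \<Rightarrow> (real ^ 'd) set" where
  "block own i = {x. \<forall>k. own k \<noteq> i \<longrightarrow> x $ k = 0}"

definition component :: "('d::finite \<Rightarrow> 'p) \<Rightarrow> 'p \<Rightarrow> real ^ 'd \<Rightarrow> real ^ 'd" where
  "component own i x = (\<chi> k. if own k = i then x $ k else 0)"

definition assemble :: "('d::finite \<Rightarrow> 'p) \<Rightarrow> ('p \<Rightarrow> real ^ 'd) \<Rightarrow> real ^ 'd" where
  "assemble own y = (\<chi> k. y (own k) $ k)"

text \<open>In the next two definitions \<open>e k\<close> is the direction of coordinate \<open>k\<close> in the domain of \<open>h\<close>, and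
  \<open>'d\<close>, \<open>'e\<close> may label states or actions: \<open>player_grad\<close> is \<open>\<partial>\<^bsub>z\<^sub>i\<^esub> h\<close> as an element of the block of
  player \<open>i\<close>, and \<open>player_hess\<close> is the matrix \<open>\<partial>\<^bsub>z\<^sub>i\<^esub>\<partial>\<^bsub>z'\<^sub>j\<^esub> h\<close>, padded by zeros.\<close>

definition player_grad ::
    "('d::finite \<Rightarrow> 'p) \<Rightarrow> ('d \<Rightarrow> 'a::real_normed_vector) \<Rightarrow> 'p \<Rightarrow> ('a \<Rightarrow> real) \<Rightarrow> 'a \<Rightarrow> real ^ 'd" where
  "player_grad own e i h p = (\<chi> k. if own k = i then partial_deriv (e k) h p else 0)"

definition player_hess ::
    "('d::finite \<Rightarrow> 'p) \<Rightarrow> ('d \<Rightarrow> 'a::real_normed_vector) \<Rightarrow> 'p \<Rightarrow>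
     ('e::finite \<Rightarrow> 'p) \<Rightarrow> ('e \<Rightarrow> 'a) \<Rightarrow> 'p \<Rightarrow> ('a \<Rightarrow> real) \<Rightarrow> 'a \<Rightarrow> real ^ 'e ^ 'd" where
  "player_hess own e i own' e' j h p =
     (\<chi> k l. if own k = i \<and> own' l = j then partial_deriv (e k) (partial_deriv (e' l) h) p else 0)"

definition x_dir :: "'d::finite \<Rightarrow> real ^ 'd" where
  "x_dir k = axis k 1"

definition xa_dir_x :: "'d::finite \<Rightarrow> (real ^ 'd) \<times> (real ^ 'e::finite)" where
  "xa_dir_x k = (axis k 1, 0)"

definition xa_dir_a :: "'e::finite \<Rightarrow> (real ^ 'd::finite) \<times> (real ^ 'e)" where
  "xa_dir_a l = (0, axis l 1)"

section \<open>Distributed games\<close>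

text \<open>The players are the elements of the finite type \<open>'p\<close>. The field \<open>state i t y \<phi>\<close> is the process
  written \<open>X\<^bsup>t,y,\<phi>\<^esup>\<close> for player \<open>i\<close>; it is fixed by the data because weak uniqueness only determines it
  up to its law.\<close>

record ('w, 'p, 'd::finite, 'e::finite, 'm::finite) dist_game =
  horizon :: real
  prob_sp :: "'w measure"
  bm :: "real \<Rightarrow> 'w \<Rightarrow> real ^ 'm"
  own_x :: "'d \<Rightarrow> 'p"
  own_a :: "'e \<Rightarrow> 'p"
  actions :: "'p \<Rightarrow> (real ^ 'e) set"
  drift :: "'p \<Rightarrow> real \<times> (real ^ 'd) \<times> (real ^ 'e) \<Rightarrow> real ^ 'd"
  diffusion :: "'p \<Rightarrow> real \<times> (real ^ 'd) \<times> (real ^ 'e) \<Rightarrow> real ^ 'm ^ 'd"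
  running :: "'p \<Rightarrow> real \<times> (real ^ 'd) \<times> (real ^ 'e) \<Rightarrow> real"
  terminal :: "'p \<Rightarrow> real ^ 'd \<Rightarrow> real"
  state :: "'p \<Rightarrow> real \<Rightarrow> real ^ 'd \<Rightarrow> (real \<times> (real ^ 'd) \<Rightarrow> real ^ 'e) \<Rightarrow>
    real \<Rightarrow> 'w \<Rightarrow> real ^ 'd"

text \<open>A weak solution on the given probability space and driven by the given Brownian motion: the
  filtration, to which the solution is adapted, is part of the solution. Square-integrability is
  \<open>E[sup\<^bsub>s\<^esub> |X\<^sub>s|\<^sup>2] < \<infinity>\<close>.\<close>

definition sq_int_weak_solution ::
    "('w, 'p, 'd::finite, 'e::finite, 'm::finite) dist_game \<Rightarrow> 'p \<Rightarrow>
     (real \<times> (real ^ 'd) \<Rightarrow> real ^ 'e) \<Rightarrow> real \<Rightarrow> real ^ 'd \<Rightarrow> (real \<Rightarrow> 'w \<Rightarrow> real ^ 'd) \<Rightarrow> bool" where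
  "sq_int_weak_solution G i \<phi> t y X \<longleftrightarrow>
    (let M = prob_sp G; T = horizon G; W = bm G;
         \<beta> = (\<lambda>s \<omega>. drift G i (s, X s \<omega>, \<phi> (s, X s \<omega>)));
         \<Sigma> = (\<lambda>s \<omega>. diffusion G i (s, X s \<omega>, \<phi> (s, X s \<omega>)))
     in \<exists>\<F>. brownian_motion_wrt M \<F> T W \<and>
       (\<forall>s\<in>{t..T}. X s \<in> borel_measurable (\<F> s)) \<and>
       (\<forall>\<omega>\<in>space M. continuous_on {t..T} (\<lambda>s. X s \<omega>) \<and> (\<forall>s\<in>{t..T}. X s \<omega> \<in> block (own_x G) i)) \<and>
       (\<integral>\<^sup>+ \<omega>. (SUP s\<in>{t..T}. ennreal ((norm (X s \<omega>))\<^sup>2)) \<partial>M) < \<infinity> \<and>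
       (AE \<omega> in M. set_integrable lborel {t..T} (\<lambda>s. \<beta> s \<omega>)) \<and>
       (\<exists>I. is_stochastic_integral M \<F> W t T \<Sigma> I \<and>
          (AE \<omega> in M. \<forall>s\<in>{t..T}. X s \<omega> = y + (LBINT u:{t..s}. \<beta> u \<omega>) + I s \<omega>)))"

definition same_law ::
    "'w measure \<Rightarrow> real set \<Rightarrow> (real \<Rightarrow> 'w \<Rightarrow> 'a::topological_space) \<Rightarrow> (real \<Rightarrow> 'w \<Rightarrow> 'a) \<Rightarrow> bool" where
  "same_law M J X Y \<longleftrightarrow>
     distr M (\<Pi>\<^sub>M s\<in>J. borel) (\<lambda>\<omega>. \<lambda>s\<in>J. X s \<omega>) = distr M (\<Pi>\<^sub>M s\<in>J. borel) (\<lambda>\<omega>. \<lambda>s\<in>J. Y s \<omega>)"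

text \<open>Policies are extensional on \<open>[0,T] \<times> \<real>\<^bsup>n\<^sub>i\<^esup>\<close>, so that they correspond one to one to functions with
  that domain.\<close>

definition policies ::
    "('w, 'p, 'd::finite, 'e::finite, 'm::finite) dist_game \<Rightarrow> 'p \<Rightarrow>
     (real \<times> (real ^ 'd) \<Rightarrow> real ^ 'e) set" where
  "policies G i =
    (let D = {0..horizon G} \<times> block (own_x G) i in
     {\<phi> \<in> D \<rightarrow>\<^sub>E actions G i.
        \<phi> \<in> borel_measurable (restrict_space borel D) \<and>
        bdd_above ((\<lambda>(t, y). norm (\<phi> (t, y)) / (1 + norm y)) ` D) \<and>
        (\<forall>(t, y)\<in>D.
           (\<exists>X. sq_int_weak_solution G i \<phi> t y X) \<and>
           (\<forall>X Y. sq_int_weak_solution G i \<phi> t y X \<and> sq_int_weak_solution G i \<phi> t y Y \<longrightarrow>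
              same_law (prob_sp G) {t..horizon G} X Y))})"

definition distributed_game ::
    "('w, 'p::finite, 'd::finite, 'e::finite, 'm::finite) dist_game \<Rightarrow> bool" where
  "distributed_game G \<longleftrightarrow>
     0 < horizon G \<and>
     prob_space (prob_sp G) \<and>
     brownian_motion (prob_sp G) (horizon G) (bm G) \<and>
     (\<forall>i. actions G i \<in> sets borel \<and> actions G i \<subseteq> block (own_a G) i) \<and>
     (\<forall>i. let D = {0..horizon G} \<times> block (own_x G) i \<times> block (own_a G) i in
        drift G i \<in> borel_measurable (restrict_space borel D) \<and>
        diffusion G i \<in> borel_measurable (restrict_space borel D) \<and>
        (\<forall>z\<in>D. drift G i z \<in> block (own_x G) i \<and>
               (\<forall>k. own_x G k \<noteq> i \<longrightarrow> diffusion G i z $ k = 0))) \<and>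
     (\<forall>i. running G i \<in> borel_measurable (restrict_space borel ({0..horizon G} \<times> UNIV \<times> UNIV)) \<and>
        bdd_above ((\<lambda>(t, x, a). \<bar>running G i (t, x, a)\<bar> / (1 + (norm x)\<^sup>2 + (norm a)\<^sup>2)) `
          ({0..horizon G} \<times> UNIV \<times> UNIV))) \<and>
     (\<forall>i. terminal G i \<in> borel_measurable borel \<and>
        bdd_above (range (\<lambda>x. \<bar>terminal G i x\<bar> / (1 + (norm x)\<^sup>2)))) \<and>
     (\<forall>i. \<forall>\<phi>\<in>policies G i. \<forall>t\<in>{0..horizon G}. \<forall>y\<in>block (own_x G) i.
        sq_int_weak_solution G i \<phi> t y (state G i t y \<phi>))"

type_synonym ('p, 'd, 'e) profile = "'p \<Rightarrow> real \<times> (real ^ 'd) \<Rightarrow> real ^ 'e"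

definition joint_state ::
    "('w, 'p, 'd::finite, 'e::finite, 'm::finite) dist_game \<Rightarrow> real \<Rightarrow> real ^ 'd \<Rightarrow>
     ('p, 'd, 'e) profile \<Rightarrow> real \<Rightarrow> 'w \<Rightarrow> real ^ 'd" where
  "joint_state G t x \<phi> s \<omega> =
     assemble (own_x G) (\<lambda>i. state G i t (component (own_x G) i x) (\<phi> i) s \<omega>)"

definition joint_control ::
    "('w, 'p, 'd::finite, 'e::finite, 'm::finite) dist_game \<Rightarrow> real \<Rightarrow> real ^ 'd \<Rightarrow>
     ('p, 'd, 'e) profile \<Rightarrow> real \<Rightarrow> 'w \<Rightarrow> real ^ 'e" where
  "joint_control G t x \<phi> s \<omega> =
     assemble (own_a G)
       (\<lambda>i. \<phi> i (s, state G i t (component (own_x G) i x) (\<phi> i) s \<omega>))"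

definition objective ::
    "('w, 'p, 'd::finite, 'e::finite, 'm::finite) dist_game \<Rightarrow>
     (real \<times> (real ^ 'd) \<times> (real ^ 'e) \<Rightarrow> real) \<Rightarrow> (real ^ 'd \<Rightarrow> real) \<Rightarrow>
     real \<Rightarrow> real ^ 'd \<Rightarrow> ('p, 'd, 'e) profile \<Rightarrow> real" where
  "objective G F g t x \<phi> =
     (\<integral>\<omega>. (LBINT s:{t..horizon G}. F (s, joint_state G t x \<phi> s \<omega>, joint_control G t x \<phi> s \<omega>)) +
          g (joint_state G t x \<phi> (horizon G) \<omega>) \<partial>prob_sp G)"

definition value_function ::
    "('w, 'p, 'd::finite, 'e::finite, 'm::finite) dist_game \<Rightarrow> 'p \<Rightarrow>
     real \<Rightarrow> real ^ 'd \<Rightarrow> ('p, 'd, 'e) profile \<Rightarrow> real" where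
  "value_function G i = objective G (running G i) (terminal G i)"

definition markov_potential_game_with ::
    "('w, 'p, 'd::finite, 'e::finite, 'm::finite) dist_game \<Rightarrow>
     (real \<Rightarrow> real ^ 'd \<Rightarrow> ('p, 'd, 'e) profile \<Rightarrow> real) \<Rightarrow> bool" where
  "markov_potential_game_with G \<Phi> \<longleftrightarrow>
     (\<forall>t\<in>{0..horizon G}. \<forall>x i. \<forall>\<phi>\<^sub>i\<in>policies G i. \<forall>\<phi>\<^sub>i'\<in>policies G i.
        \<forall>\<phi>. (\<forall>j. j \<noteq> i \<longrightarrow> \<phi> j \<in> policies G j) \<longrightarrow>
          \<Phi> t x (\<phi>(i := \<phi>\<^sub>i')) - \<Phi> t x (\<phi>(i := \<phi>\<^sub>i)) =
          value_function G i t x (\<phi>(i := \<phi>\<^sub>i')) - value_function G i t x (\<phi>(i := \<phi>\<^sub>i)))"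

definition potential_running ::
    "('w, 'p::finite, 'd::finite, 'e::finite, 'm::finite) dist_game \<Rightarrow> real ^ 'd \<Rightarrow> real ^ 'e \<Rightarrow>
     real \<times> (real ^ 'd) \<times> (real ^ 'e) \<Rightarrow> real" where
  "potential_running G x0 a0 = (\<lambda>(t, x, a).
     \<Sum>i\<in>UNIV. LBINT r:{0..1}.
       (let f = (\<lambda>p. running G i (t, p)); p = (x0 + r *\<^sub>R (x - x0), a0 + r *\<^sub>R (a - a0)) in
        (player_grad (own_x G) xa_dir_x i f p, player_grad (own_a G) xa_dir_a i f p) \<bullet>
        (component (own_x G) i (x - x0), component (own_a G) i (a - a0))))"

definition potential_terminal ::
    "('w, 'p::finite, 'd::finite, 'e::finite, 'm::finite) dist_game \<Rightarrow> real ^ 'd \<Rightarrow>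
     real ^ 'd \<Rightarrow> real" where
  "potential_terminal G x0 x =
     (\<Sum>i\<in>UNIV. LBINT r:{0..1}.
        player_grad (own_x G) x_dir i (terminal G i) (x0 + r *\<^sub>R (x - x0)) \<bullet>
        component (own_x G) i (x - x0))"

end

theory Submission
  imports Defs
begin

text \<open>
  Write \<open>z = (x, a)\<close>, and let \<open>k\<close> range over all scalar coordinates, \<open>own k\<close> being the player to whom
  the coordinate belongs. At each time the potential cost \<open>F\<close> is the integral of
  \<open>\<Sum>\<^sub>k \<partial>\<^sub>k f\<^bsub>own k\<^esub> dz\<^sub>k\<close> along the segment from \<open>z0\<close> to \<open>z\<close>, while \<open>f\<^sub>i(z) - f\<^sub>i(z0)\<close> is the integral of
  \<open>\<Sum>\<^sub>k \<partial>\<^sub>k f\<^sub>i dz\<^sub>k\<close> along the same segment. In the difference of the two forms the coordinates of player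
  \<open>i\<close> drop out, and the coefficient \<open>\<partial>\<^sub>k f\<^sub>j - \<partial>\<^sub>k f\<^sub>i\<close> of a coordinate of another player \<open>j\<close> has derivative
  zero in every direction of player \<open>i\<close>: this is the equality of the mixed Hessian blocks of \<open>f\<^sub>i\<close> and
  \<open>f\<^sub>j\<close>. Hence \<open>F - f\<^sub>i\<close> does not change when only the coordinates of player \<open>i\<close> change
  (\<open>line_potential_exact\<close>). The same argument applies to the terminal costs.

  In a distributed game, a deviation of player \<open>i\<close> changes only the coordinates of player \<open>i\<close> in the
  joint state and control, path by path. So the objective with costs \<open>F - f\<^sub>i\<close> and \<open>G - g\<^sub>i\<close> has the same
  value before and after the deviation, and the theorem follows once this objective is split by
  linearity (\<open>objective_diff\<close>).

  Linearity requires integrability. The costs of the game grow at most quadratically, and so do \<open>F\<close> and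
  \<open>G\<close> (\<open>quadratic_cost_line_potential\<close>): moving from \<open>z0\<close> to \<open>z\<close> one player after the other, exactness
  turns \<open>F\<close> into a finite sum of increments of the \<open>f\<^sub>i\<close>, which gives both its measurability and its
  growth. The joint state and control are jointly measurable and have second moments bounded uniformly
  in time, because the states are square integrable and the policies grow at most linearly
  (\<open>joint_process_L2_bounded\<close>).
\<close>

section \<open>Line integrals of the players' own gradients\<close>

text \<open>The coordinates of \<open>z\<close> are its inner products with the directions \<open>e k\<close>. Keeping the directions
  abstract treats running costs, where they are state and action directions, and terminal costs, where
  they are state directions, at the same time.\<close>

definition line_potential ::
    "('k::finite \<Rightarrow> 'p::finite) \<Rightarrow> ('k \<Rightarrow> 'z::real_inner) \<Rightarrow> ('p \<Rightarrow> 'z \<Rightarrow> real) \<Rightarrow> 'z \<Rightarrow> 'z \<Rightarrow> real" where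
  "line_potential own e f z0 z =
     (\<Sum>i\<in>UNIV. LBINT r:{0..1}. \<Sum>k\<in>{k. own k = i}.
        partial_deriv (e k) (f i) (z0 + r *\<^sub>R (z - z0)) * ((z - z0) \<bullet> e k))"

lemma partial_deriv_eq:
  assumes "(h has_derivative h') (at p)"
  shows "partial_deriv v h p = h' v"
proof -
  have "((\<lambda>r::real. p + r *\<^sub>R v) has_derivative (\<lambda>r. r *\<^sub>R v)) (at 0)"
    by (auto intro!: derivative_eq_intros)
  then have "((\<lambda>r::real. h (p + r *\<^sub>R v)) has_derivative (\<lambda>r. h' (r *\<^sub>R v))) (at 0)"
    by (rule has_derivative_compose) (use assms in simp)
  moreover have "h' (r *\<^sub>R v) = h' v * r" for r
    using has_derivative_linear[OF assms] by (simp add: linear_scale)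
  ultimately have "((\<lambda>r::real. h (p + r *\<^sub>R v)) has_field_derivative h' v) (at 0)"
    by (simp add: has_field_derivative_def)
  then show ?thesis
    unfolding partial_deriv_def by (rule DERIV_imp_deriv)
qed

text \<open>Separates the running from the terminal cost in a map \<open>(x, a) \<mapsto> (f (x, a), g x)\<close>: \<open>A\<close> is a projection
  on the values and \<open>B\<close> the identity or an inclusion of the states.\<close>

lemma twice_continuously_differentiable_linear_compose:
  fixes h :: "'a::real_normed_vector \<Rightarrow> 'b::real_normed_vector"
    and A :: "'b \<Rightarrow> 'c::real_normed_vector" and B :: "'d::real_normed_vector \<Rightarrow> 'a"
  assumes h: "twice_continuously_differentiable h" and A: "bounded_linear A" and B: "bounded_linear B"
  shows "twice_continuously_differentiable (\<lambda>x. A (h (B x)))"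
proof -
  obtain h' and h'' where h': "\<And>p. (h has_derivative blinfun_apply (h' p)) (at p)"
    and h'': "\<And>p. (h' has_derivative blinfun_apply (h'' p)) (at p)" and c: "continuous_on UNIV h''"
    using h unfolding twice_continuously_differentiable_def by blast
  define a where "a = Blinfun A"
  define b where "b = Blinfun B"
  have a: "blinfun_apply a = A" and b: "blinfun_apply b = B"
    using A B by (simp_all add: a_def b_def bounded_linear_Blinfun_apply)
  \<comment> \<open>The derivative of \<open>a o\<^sub>L h' (B x) o\<^sub>L b\<close> in \<open>x\<close> is \<open>h''\<close> followed by this linear map of operators.\<close>
  have sandwich: "bounded_linear (\<lambda>K. a o\<^sub>L K o\<^sub>L b)"
    by (intro bounded_linear_compose[OF bounded_bilinear.bounded_linear_left[OF bounded_bilinear_blinfun_compose]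
        bounded_bilinear.bounded_linear_right[OF bounded_bilinear_blinfun_compose]])
  define q where "q = Blinfun (\<lambda>K. a o\<^sub>L K o\<^sub>L b)"
  have q: "blinfun_apply q = (\<lambda>K. a o\<^sub>L K o\<^sub>L b)"
    using sandwich by (simp add: q_def bounded_linear_Blinfun_apply)
  have dB: "(B has_derivative B) (at x)" for x
    using B by (rule bounded_linear_imp_has_derivative)
  have "((\<lambda>x. A (h (B x))) has_derivative blinfun_apply (a o\<^sub>L h' (B x) o\<^sub>L b)) (at x)" for x
    using bounded_linear.has_derivative[OF A has_derivative_compose[OF dB h']]
    by (rule has_derivative_eq_rhs) (simp add: fun_eq_iff a b)
  moreover have "((\<lambda>x. a o\<^sub>L h' (B x) o\<^sub>L b) has_derivative blinfun_apply (q o\<^sub>L h'' (B x) o\<^sub>L b)) (at x)" for x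
    using bounded_linear.has_derivative[OF sandwich has_derivative_compose[OF dB h'']]
    by (rule has_derivative_eq_rhs) (simp add: fun_eq_iff q b)
  moreover have "continuous_on UNIV (\<lambda>x. q o\<^sub>L h'' (B x) o\<^sub>L b)"
    by (intro bounded_bilinear.continuous_on[OF bounded_bilinear_blinfun_compose] continuous_intros
        continuous_on_compose2[OF c] linear_continuous_on B) auto
  ultimately show ?thesis
    unfolding twice_continuously_differentiable_def
    by (intro exI[of _ "\<lambda>x. a o\<^sub>L h' (B x) o\<^sub>L b"] exI[of _ "\<lambda>x. q o\<^sub>L h'' (B x) o\<^sub>L b"]) simp
qed

lemma twice_continuously_differentiable_partial_deriv:
  assumes "twice_continuously_differentiable h"
  obtains h' h'' where
    "\<And>p. (h has_derivative blinfun_apply (h' p)) (at p)"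
    "\<And>v p. partial_deriv v h p = h' p v"
    "\<And>v p. (partial_deriv v h has_derivative (\<lambda>u. blinfun_apply (h'' p u) v)) (at p)"
    "\<And>u v p. partial_deriv u (partial_deriv v h) p = blinfun_apply (h'' p u) v"
    "\<And>v. continuous_on UNIV (partial_deriv v h)"
proof -
  obtain h' and h'' where h': "\<And>p. (h has_derivative blinfun_apply (h' p)) (at p)"
    and h'': "\<And>p. (h' has_derivative blinfun_apply (h'' p)) (at p)"
    using assms unfolding twice_continuously_differentiable_def by blast
  have p: "partial_deriv v h = (\<lambda>p. h' p v)" for v
    by (rule ext) (rule partial_deriv_eq[OF h'])
  have d: "(partial_deriv v h has_derivative (\<lambda>u. blinfun_apply (h'' q u) v)) (at q)" for v q
    unfolding p by (rule bounded_linear.has_derivative[OF blinfun.bounded_linear_left h''])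
  show ?thesis
  proof (rule that[of h' h''])
    show "continuous_on UNIV (partial_deriv v h)" for v
      using d by (meson continuous_at_imp_continuous_on has_derivative_continuous)
  qed (use p h' d partial_deriv_eq[OF d] in auto)
qed

lemma integral_gradient_along_segment:
  assumes f: "twice_continuously_differentiable (f :: 'z::real_inner \<Rightarrow> real)"
    and expand: "\<And>z. z = (\<Sum>k\<in>(UNIV::'k::finite set). (z \<bullet> e k) *\<^sub>R e k)"
  shows "(LBINT r:{0..1}. \<Sum>k\<in>UNIV.
            partial_deriv (e k) f (z0 + r *\<^sub>R (z - z0)) * ((z - z0) \<bullet> e k)) = f z - f z0"
proof -
  obtain f' f'' where f': "\<And>p. (f has_derivative blinfun_apply (f' p)) (at p)"
    and pd: "\<And>v p. partial_deriv v f p = blinfun_apply (f' p) v"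
    and c: "\<And>v. continuous_on UNIV (partial_deriv v f)"
    using f by (rule twice_continuously_differentiable_partial_deriv) blast
  let ?\<gamma> = "\<lambda>r::real. z0 + r *\<^sub>R (z - z0)"
  have sum: "(\<Sum>k\<in>UNIV. partial_deriv (e k) f (?\<gamma> r) * ((z - z0) \<bullet> e k)) = f' (?\<gamma> r) (z - z0)" for r
  proof -
    have "f' (?\<gamma> r) (z - z0) = f' (?\<gamma> r) (\<Sum>k\<in>UNIV. ((z - z0) \<bullet> e k) *\<^sub>R e k)"
      by (rule arg_cong[OF expand])
    then show ?thesis
      by (simp add: blinfun.sum_right blinfun.scaleR_right pd mult.commute)
  qed
  have "((\<lambda>r. f (?\<gamma> r)) has_vector_derivative f' (?\<gamma> r) (z - z0)) (at r within {0..1})" for r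
  proof -
    have "(?\<gamma> has_derivative (\<lambda>s. s *\<^sub>R (z - z0))) (at r within {0..1})"
      by (auto intro!: derivative_eq_intros)
    from has_derivative_compose[OF this f'] show ?thesis
      by (simp add: has_vector_derivative_def blinfun.scaleR_right)
  qed
  moreover have "continuous_on {0..1} (\<lambda>r. f' (?\<gamma> r) (z - z0))"
    unfolding sum[symmetric]
    by (intro continuous_intros continuous_on_compose2[OF c]) auto
  ultimately have "(LBINT r:{0..1}. f' (?\<gamma> r) (z - z0)) = f (?\<gamma> 1) - f (?\<gamma> 0)"
    unfolding set_lebesgue_integral_def by (intro integral_FTC_atLeastAtMost) auto
  then show ?thesis
    by (simp add: sum)
qed

lemma set_integral_sum:
  fixes f :: "'k \<Rightarrow> 'a \<Rightarrow> real"
  assumes "\<And>k. k \<in> K \<Longrightarrow> set_integrable M A (f k)"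
  shows "set_integrable M A (\<lambda>x. \<Sum>k\<in>K. f k x)"
    and "(LINT x:A|M. \<Sum>k\<in>K. f k x) = (\<Sum>k\<in>K. LINT x:A|M. f k x)"
  using assms unfolding set_integrable_def set_lebesgue_integral_def
  by (simp_all add: scaleR_sum_right del: real_scaleR_def)

text \<open>Both \<open>line_potential\<close> and the increment of \<open>f i\<close> are integrals over the same segment, so that the summands
  with \<open>own k = i\<close> cancel.\<close>

lemma line_potential_minus_cost:
  fixes f :: "'p::finite \<Rightarrow> 'z::real_inner \<Rightarrow> real" and own :: "'k::finite \<Rightarrow> 'p"
  assumes f: "\<And>i. twice_continuously_differentiable (f i)"
    and expand: "\<And>z. z = (\<Sum>k\<in>UNIV. (z \<bullet> e k) *\<^sub>R e k)"
  shows "line_potential own e f z0 z - (f i z - f i z0) =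
    (LBINT r:{0..1}. \<Sum>k\<in>UNIV.
       (partial_deriv (e k) (f (own k)) (z0 + r *\<^sub>R (z - z0)) -
        partial_deriv (e k) (f i) (z0 + r *\<^sub>R (z - z0))) * ((z - z0) \<bullet> e k))"
proof -
  let ?d = "\<lambda>j k r. partial_deriv (e k) (f j) (z0 + r *\<^sub>R (z - z0)) * ((z - z0) \<bullet> e k)"
  have c: "continuous_on UNIV (partial_deriv v (f j))" for v j
    using f[of j] by (rule twice_continuously_differentiable_partial_deriv) simp
  have "continuous_on {0..1} (?d j k)" for j k
    by (intro continuous_intros continuous_on_compose2[OF c]) auto
  then have int: "set_integrable lborel {0..1} (?d j k)" for j k
    unfolding set_integrable_def by (intro borel_integrable_compact) auto
  then have int_sum: "set_integrable lborel {0..1} (\<lambda>r. \<Sum>k\<in>K. ?d (g k) k r)" for K and g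
    by (intro set_integral_sum(1)) auto
  have "line_potential own e f z0 z = (\<Sum>i\<in>UNIV. \<Sum>k\<in>{k. own k = i}. LBINT r:{0..1}. ?d i k r)"
    unfolding line_potential_def by (intro sum.cong refl set_integral_sum(2) int)
  also have "\<dots> = (\<Sum>i\<in>UNIV. \<Sum>k\<in>{k. own k = i}. LBINT r:{0..1}. ?d (own k) k r)"
    by (intro sum.cong refl) auto
  also have "\<dots> = (\<Sum>k\<in>UNIV. LBINT r:{0..1}. ?d (own k) k r)"
    using sum.group[of "UNIV :: 'k set" "UNIV :: 'p set" own "\<lambda>k. LBINT r:{0..1}. ?d (own k) k r"]
    by simp
  also have "\<dots> = (LBINT r:{0..1}. \<Sum>k\<in>UNIV. ?d (own k) k r)"
    by (intro set_integral_sum(2)[symmetric] int)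
  finally have "line_potential own e f z0 z - (f i z - f i z0) =
      (LBINT r:{0..1}. \<Sum>k\<in>UNIV. ?d (own k) k r) - (LBINT r:{0..1}. \<Sum>k\<in>UNIV. ?d i k r)"
    by (simp add: integral_gradient_along_segment[OF f expand])
  also have "\<dots> = (LBINT r:{0..1}. (\<Sum>k\<in>UNIV. ?d (own k) k r) - (\<Sum>k\<in>UNIV. ?d i k r))"
    by (intro set_integral_diff(2)[symmetric] int_sum)
  finally show ?thesis
    by (simp add: sum_subtractf left_diff_distrib)
qed

text \<open>The derivative of \<open>\<partial>\<^sub>l f\<^bsub>own l\<^esub> - \<partial>\<^sub>l f\<^sub>i\<close> in a direction \<open>e k\<close> with \<open>own k = i\<close> is a difference of two Hessian
  entries that \<open>hess\<close> identifies. It therefore vanishes along \<open>w\<close>, and the function is constant on lines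
  in direction \<open>w\<close>.\<close>

lemma partial_deriv_difference_block_invariant:
  fixes f :: "'p \<Rightarrow> 'z::real_inner \<Rightarrow> real" and own :: "'k::finite \<Rightarrow> 'p"
  assumes f: "\<And>i. twice_continuously_differentiable (f i)"
    and expand: "\<And>z. z = (\<Sum>k\<in>UNIV. (z \<bullet> e k) *\<^sub>R e k)"
    and hess: "\<And>k l p. partial_deriv (e k) (partial_deriv (e l) (f (own k))) p =
      partial_deriv (e k) (partial_deriv (e l) (f (own l))) p"
    and w: "\<And>k. own k \<noteq> i \<Longrightarrow> w \<bullet> e k = 0"
  shows "partial_deriv (e l) (f (own l)) (p + w) - partial_deriv (e l) (f i) (p + w) =
    partial_deriv (e l) (f (own l)) p - partial_deriv (e l) (f i) p"
proof -
  define h where "h p = partial_deriv (e l) (f (own l)) p - partial_deriv (e l) (f i) p" for p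
  define J where "J = own l"
  obtain F where dF: "\<And>p. (partial_deriv (e l) (f J) has_derivative (\<lambda>u. blinfun_apply (F p u) (e l))) (at p)"
    and ddF: "\<And>u p. partial_deriv u (partial_deriv (e l) (f J)) p = blinfun_apply (F p u) (e l)"
    using f[of J] by (rule twice_continuously_differentiable_partial_deriv) blast
  obtain H where dH: "\<And>p. (partial_deriv (e l) (f i) has_derivative (\<lambda>u. blinfun_apply (H p u) (e l))) (at p)"
    and ddH: "\<And>u p. partial_deriv u (partial_deriv (e l) (f i)) p = blinfun_apply (H p u) (e l)"
    using f[of i] by (rule twice_continuously_differentiable_partial_deriv) blast
  let ?D = "\<lambda>p u. blinfun_apply (F p u) (e l) - blinfun_apply (H p u) (e l)"
  have dh: "(h has_derivative ?D p) (at p)" for p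
    unfolding h_def J_def[symmetric] by (intro derivative_intros dF dH)
  have block: "?D p (e k) = 0" if "own k = i" for k p
    using hess[of k l p] that by (simp add: J_def[symmetric] ddF ddH)
  have zero: "?D p w = 0" for p
  proof -
    have "?D p w = ?D p (\<Sum>k\<in>UNIV. (w \<bullet> e k) *\<^sub>R e k)"
      by (rule arg_cong[where f = "?D p", OF expand])
    also have "\<dots> = (\<Sum>k\<in>UNIV. (w \<bullet> e k) * ?D p (e k))"
      by (simp add: linear_sum[OF has_derivative_linear[OF dh]]
          linear_scale[OF has_derivative_linear[OF dh]])
    also have "\<dots> = 0"
      using block w by (intro sum.neutral ballI) (metis mult_eq_0_iff)
    finally show ?thesis .
  qed
  have "((\<lambda>s::real. h (p + s *\<^sub>R w)) has_real_derivative 0) (at s)" for s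
  proof -
    have "((\<lambda>s::real. p + s *\<^sub>R w) has_derivative (\<lambda>r. r *\<^sub>R w)) (at s)"
      by (auto intro!: derivative_eq_intros)
    from has_derivative_compose[OF this dh] have
      "((\<lambda>s. h (p + s *\<^sub>R w)) has_derivative (\<lambda>r. ?D (p + s *\<^sub>R w) (r *\<^sub>R w))) (at s)" .
    moreover have "(\<lambda>r. ?D (p + s *\<^sub>R w) (r *\<^sub>R w)) = (*) 0"
      using linear_scale[OF has_derivative_linear[OF dh], of "p + s *\<^sub>R w" _ w] zero by auto
    ultimately show ?thesis
      by (simp only: has_field_derivative_def)
  qed
  then have "h (p + 1 *\<^sub>R w) = h (p + 0 *\<^sub>R w)"
    by (intro DERIV_isconst_all) blast
  then show ?thesis
    by (simp add: h_def)
qed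

text \<open>The integrand in \<open>line_potential_minus_cost\<close> is the same for \<open>z\<close> and \<open>z'\<close>: a coordinate of player \<open>i\<close>
  contributes zero, and at any other coordinate the increments agree while the base points differ by a
  vector in the block of player \<open>i\<close>.\<close>

lemma line_potential_exact:
  fixes f :: "'p::finite \<Rightarrow> 'z::real_inner \<Rightarrow> real" and own :: "'k::finite \<Rightarrow> 'p"
  assumes f: "\<And>i. twice_continuously_differentiable (f i)"
    and expand: "\<And>z. z = (\<Sum>k\<in>UNIV. (z \<bullet> e k) *\<^sub>R e k)"
    and hess: "\<And>k l p. partial_deriv (e k) (partial_deriv (e l) (f (own k))) p =
      partial_deriv (e k) (partial_deriv (e l) (f (own l))) p"
    and agree: "\<And>k. own k \<noteq> i \<Longrightarrow> z \<bullet> e k = z' \<bullet> e k"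
  shows "line_potential own e f z0 z' - f i z' = line_potential own e f z0 z - f i z"
proof -
  have summand: "(partial_deriv (e k) (f (own k)) (z0 + r *\<^sub>R (z' - z0)) -
        partial_deriv (e k) (f i) (z0 + r *\<^sub>R (z' - z0))) * ((z' - z0) \<bullet> e k) =
      (partial_deriv (e k) (f (own k)) (z0 + r *\<^sub>R (z - z0)) -
        partial_deriv (e k) (f i) (z0 + r *\<^sub>R (z - z0))) * ((z - z0) \<bullet> e k)" for k and r :: real
  proof (cases "own k = i")
    case False
    have "z0 + r *\<^sub>R (z' - z0) = (z0 + r *\<^sub>R (z - z0)) + r *\<^sub>R (z' - z)"
      by (simp add: algebra_simps)
    moreover have "partial_deriv (e k) (f (own k)) (p + r *\<^sub>R (z' - z)) -
        partial_deriv (e k) (f i) (p + r *\<^sub>R (z' - z)) =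
      partial_deriv (e k) (f (own k)) p - partial_deriv (e k) (f i) p" for p
      by (rule partial_deriv_difference_block_invariant[where f = f and own = own and e = e and i = i,
            OF f expand hess])
        (simp add: agree inner_diff_left)
    moreover have "(z' - z0) \<bullet> e k = (z - z0) \<bullet> e k"
      using agree[OF False] by (simp add: inner_diff_left)
    ultimately show ?thesis
      by metis
  qed simp
  have "line_potential own e f z0 z' - (f i z' - f i z0) = line_potential own e f z0 z - (f i z - f i z0)"
    by (simp only: line_potential_minus_cost[where f = f and e = e, OF f expand] summand)
  then show ?thesis
    by simp
qed

lemma line_potential_base: "line_potential own e f z0 z0 = 0"
  by (simp add: line_potential_def)

section \<open>Processes with bounded second moments\<close>

text \<open>The process is the pointwise limit of its values at the grid points \<open>\<lfloor>s (n + 1)\<rfloor> / (n + 1)\<close>, and the time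
  argument of each approximation takes countably many values.\<close>

lemma continuous_process_jointly_measurable:
  fixes X :: "real \<Rightarrow> 'w \<Rightarrow> 'a::metric_space"
  assumes meas: "\<And>s. s \<in> {t..T} \<Longrightarrow> X s \<in> borel_measurable M"
    and cont: "\<And>\<omega>. \<omega> \<in> space M \<Longrightarrow> continuous_on {t..T} (\<lambda>s. X s \<omega>)"
    and "t \<le> T"
  shows "(\<lambda>(s, \<omega>). X s \<omega>) \<in> borel_measurable (restrict_space lborel {t..T} \<Otimes>\<^sub>M M)"
proof -
  \<comment> \<open>The grid point just below \<open>s\<close> may lie to the left of \<open>t\<close>, where \<open>X\<close> is unrestricted.\<close>
  define clamp where "clamp r = max t (min T r)" for r
  have clamp: "clamp r \<in> {t..T}" for r
    using \<open>t \<le> T\<close> by (auto simp: clamp_def)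
  have grid: "(\<lambda>n. real_of_int \<lfloor>s * real (Suc n)\<rfloor> / real (Suc n)) \<longlonglongrightarrow> s" for s
  proof (rule tendsto_sandwich)
    show "\<forall>\<^sub>F n in sequentially. s - inverse (real (Suc n)) \<le> real_of_int \<lfloor>s * real (Suc n)\<rfloor> / real (Suc n)"
    proof (rule always_eventually, rule allI)
      fix n
      have "s * real (Suc n) - 1 \<le> real_of_int \<lfloor>s * real (Suc n)\<rfloor>"
        by linarith
      then have "(s * real (Suc n) - 1) / real (Suc n) \<le> real_of_int \<lfloor>s * real (Suc n)\<rfloor> / real (Suc n)"
        by (rule divide_right_mono) simp
      moreover have "(s * real (Suc n) - 1) / real (Suc n) = s - inverse (real (Suc n))"
        by (simp add: diff_divide_distrib inverse_eq_divide del: of_nat_Suc)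
      ultimately show "s - inverse (real (Suc n)) \<le> real_of_int \<lfloor>s * real (Suc n)\<rfloor> / real (Suc n)"
        by simp
    qed
    show "\<forall>\<^sub>F n in sequentially. real_of_int \<lfloor>s * real (Suc n)\<rfloor> / real (Suc n) \<le> s"
      by (intro always_eventually allI) (simp add: divide_le_eq)
    show "(\<lambda>n. s - inverse (real (Suc n))) \<longlonglongrightarrow> s"
      using tendsto_diff[OF tendsto_const LIMSEQ_inverse_real_of_nat, of s] by simp
  qed simp
  show ?thesis
  proof (rule borel_measurable_LIMSEQ_metric)
    fix n
    show "(\<lambda>(s, \<omega>). X (clamp (real_of_int \<lfloor>s * real (Suc n)\<rfloor> / real (Suc n))) \<omega>)
      \<in> borel_measurable (restrict_space lborel {t..T} \<Otimes>\<^sub>M M)" (is "?Y \<in> _")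
    proof -
      have "(\<lambda>p. X (clamp (real_of_int i / real (Suc n))) (snd p))
        \<in> borel_measurable (restrict_space lborel {t..T} \<Otimes>\<^sub>M M)" for i :: int
        using meas[OF clamp] by measurable
      moreover have "(\<lambda>p. \<lfloor>fst p * real (Suc n)\<rfloor>)
        \<in> measurable (restrict_space lborel {t..T} \<Otimes>\<^sub>M M) (count_space UNIV)"
      proof -
        have "(\<lambda>s. \<lfloor>s * real (Suc n)\<rfloor>) \<in> measurable (restrict_space lborel {t..T}) (count_space UNIV)"
          by (intro measurable_restrict_space1) simp
        from measurable_compose[OF measurable_fst this] show ?thesis .
      qed
      ultimately have "(\<lambda>p. X (clamp (real_of_int \<lfloor>fst p * real (Suc n)\<rfloor> / real (Suc n))) (snd p))
        \<in> borel_measurable (restrict_space lborel {t..T} \<Otimes>\<^sub>M M)"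
        by (rule measurable_compose_countable)
      then show ?thesis
        by (simp add: case_prod_unfold)
    qed
  next
    fix p assume "p \<in> space (restrict_space lborel {t..T} \<Otimes>\<^sub>M M)"
    then obtain s \<omega> where p: "p = (s, \<omega>)" and s: "s \<in> {t..T}" and \<omega>: "\<omega> \<in> space M"
      by (cases p) (auto simp: space_pair_measure space_restrict_space)
    have "(\<lambda>n. clamp (real_of_int \<lfloor>s * real (Suc n)\<rfloor> / real (Suc n))) \<longlonglongrightarrow> clamp s"
      unfolding clamp_def by (intro tendsto_intros grid)
    moreover have "clamp s = s"
      using s by (auto simp: clamp_def)
    ultimately have "(\<lambda>n. clamp (real_of_int \<lfloor>s * real (Suc n)\<rfloor> / real (Suc n))) \<longlonglongrightarrow> s"
      by simp
    from continuous_on_tendsto_compose[OF cont[OF \<omega>] this s] clamp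
    have "(\<lambda>n. X (clamp (real_of_int \<lfloor>s * real (Suc n)\<rfloor> / real (Suc n))) \<omega>) \<longlonglongrightarrow> X s \<omega>"
      by (simp del: of_nat_Suc)
    then show "(\<lambda>n. (\<lambda>(s, \<omega>). X (clamp (real_of_int \<lfloor>s * real (Suc n)\<rfloor> / real (Suc n))) \<omega>) p)
      \<longlonglongrightarrow> (\<lambda>(s, \<omega>). X s \<omega>) p"
      by (simp add: p)
  qed
qed

text \<open>The bound on the second moment is uniform in time, so that integrating over \<open>\<Omega>\<close> first and over the
  finite time interval afterwards gives a finite value.\<close>

definition L2_bounded :: "'w measure \<Rightarrow> real \<Rightarrow> real \<Rightarrow> (real \<Rightarrow> 'w \<Rightarrow> 'a::euclidean_space) \<Rightarrow> bool" where
  "L2_bounded M t T Y \<longleftrightarrow>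
     (\<lambda>(s, \<omega>). Y s \<omega>) \<in> borel_measurable (restrict_space lborel {t..T} \<Otimes>\<^sub>M M) \<and>
     (\<exists>K<\<infinity>. \<forall>s\<in>{t..T}. (\<integral>\<^sup>+ \<omega>. ennreal ((norm (Y s \<omega>))\<^sup>2) \<partial>M) \<le> K)"

lemma L2_bounded_measurable_at:
  assumes "L2_bounded M t T Y" "s \<in> {t..T}"
  shows "Y s \<in> borel_measurable M"
proof -
  have "(\<lambda>(s, \<omega>). Y s \<omega>) \<in> borel_measurable (restrict_space lborel {t..T} \<Otimes>\<^sub>M M)"
    using assms by (simp add: L2_bounded_def)
  from measurable_Pair2[OF this, of s] show ?thesis
    using assms by (simp add: space_restrict_space)
qed

lemma L2_bounded_dominated:
  assumes Y: "(\<lambda>(s, \<omega>). Y s \<omega>) \<in> borel_measurable (restrict_space lborel {t..T} \<Otimes>\<^sub>M M)"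
    and X: "\<And>k::'k::finite. L2_bounded M t T (X k)"
    and M: "finite_measure M"
    and le: "\<And>s \<omega>. s \<in> {t..T} \<Longrightarrow> \<omega> \<in> space M \<Longrightarrow>
      (norm (Y s \<omega>))\<^sup>2 \<le> c * (1 + (\<Sum>k\<in>UNIV. (norm (X k s \<omega>))\<^sup>2))"
  shows "L2_bounded M t T Y"
proof -
  obtain K where K: "\<And>k. K k < \<infinity>"
    "\<And>k s. s \<in> {t..T} \<Longrightarrow> (\<integral>\<^sup>+ \<omega>. ennreal ((norm (X k s \<omega>))\<^sup>2) \<partial>M) \<le> K k"
    using X unfolding L2_bounded_def by metis
  let ?B = "ennreal \<bar>c\<bar> * (emeasure M (space M) + (\<Sum>k\<in>UNIV. K k))"
  have "(\<integral>\<^sup>+ \<omega>. ennreal ((norm (Y s \<omega>))\<^sup>2) \<partial>M) \<le> ?B" if s: "s \<in> {t..T}" for s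
  proof -
    have [measurable]: "X k s \<in> borel_measurable M" for k
      by (rule L2_bounded_measurable_at[OF X s])
    have "(\<integral>\<^sup>+ \<omega>. ennreal ((norm (Y s \<omega>))\<^sup>2) \<partial>M) \<le>
        (\<integral>\<^sup>+ \<omega>. ennreal \<bar>c\<bar> * (1 + (\<Sum>k\<in>UNIV. ennreal ((norm (X k s \<omega>))\<^sup>2))) \<partial>M)"
    proof (rule nn_integral_mono)
      fix \<omega> assume "\<omega> \<in> space M"
      then have "(norm (Y s \<omega>))\<^sup>2 \<le> \<bar>c\<bar> * (1 + (\<Sum>k\<in>UNIV. (norm (X k s \<omega>))\<^sup>2))"
        using le[OF s] by (meson abs_ge_self add_nonneg_nonneg mult_right_mono order_trans sum_nonneg zero_le_one zero_le_power2)
      then have "ennreal ((norm (Y s \<omega>))\<^sup>2) \<le> ennreal (\<bar>c\<bar> * (1 + (\<Sum>k\<in>UNIV. (norm (X k s \<omega>))\<^sup>2)))"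
        by (rule ennreal_leI)
      also have "\<dots> = ennreal \<bar>c\<bar> * (1 + (\<Sum>k\<in>UNIV. ennreal ((norm (X k s \<omega>))\<^sup>2)))"
        by (simp add: ennreal_mult' ennreal_plus sum_nonneg flip: sum_ennreal)
      finally show "ennreal ((norm (Y s \<omega>))\<^sup>2) \<le> ennreal \<bar>c\<bar> * (1 + (\<Sum>k\<in>UNIV. ennreal ((norm (X k s \<omega>))\<^sup>2)))" .
    qed
    also have "\<dots> = ennreal \<bar>c\<bar> * (emeasure M (space M) + (\<Sum>k\<in>UNIV. \<integral>\<^sup>+ \<omega>. ennreal ((norm (X k s \<omega>))\<^sup>2) \<partial>M))"
      by (simp add: nn_integral_cmult nn_integral_add nn_integral_sum del: sum_ennreal)
    also have "\<dots> \<le> ?B"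
      by (intro mult_left_mono add_left_mono sum_mono K(2) s) simp
    finally show ?thesis .
  qed
  moreover have "?B < \<infinity>"
    using K(1) finite_measure.emeasure_finite[OF M, of "space M"]
    by (auto simp: ennreal_mult_less_top less_top)
  ultimately show ?thesis
    unfolding L2_bounded_def using Y by blast
qed


section \<open>Costs of quadratic growth\<close>

definition quadratic_cost :: "real set \<Rightarrow> (real \<times> 'z::euclidean_space \<Rightarrow> real) \<Rightarrow> bool" where
  "quadratic_cost S F \<longleftrightarrow>
     F \<in> borel_measurable (restrict_space borel (S \<times> UNIV)) \<and>
     (\<exists>C. \<forall>s\<in>S. \<forall>z. \<bar>F (s, z)\<bar> \<le> C * (1 + (norm z)\<^sup>2))"

lemma quadratic_cost_cong:
  assumes "quadratic_cost S F" and "\<And>s z. s \<in> S \<Longrightarrow> F' (s, z) = F (s, z)"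
  shows "quadratic_cost S F'"
proof -
  have "F' \<in> borel_measurable (restrict_space borel (S \<times> UNIV)) \<longleftrightarrow>
      F \<in> borel_measurable (restrict_space borel (S \<times> UNIV))"
    by (rule measurable_cong) (auto simp: space_restrict_space assms(2))
  then show ?thesis
    using assms by (simp add: quadratic_cost_def)
qed

lemma quadratic_cost_add:
  assumes "quadratic_cost S F" "quadratic_cost S F'"
  shows "quadratic_cost S (\<lambda>p. F p + F' p)"
proof -
  obtain C C' where C: "\<And>s z. s \<in> S \<Longrightarrow> \<bar>F (s, z)\<bar> \<le> C * (1 + (norm z)\<^sup>2)"
    and C': "\<And>s z. s \<in> S \<Longrightarrow> \<bar>F' (s, z)\<bar> \<le> C' * (1 + (norm z)\<^sup>2)"
    using assms unfolding quadratic_cost_def by metis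
  have "\<bar>F (s, z) + F' (s, z)\<bar> \<le> (C + C') * (1 + (norm z)\<^sup>2)" if "s \<in> S" for s z
    using C[OF that, of z] C'[OF that, of z] unfolding distrib_right[of C] by linarith
  then show ?thesis
    using assms unfolding quadratic_cost_def by (auto intro!: borel_measurable_add)
qed

lemma quadratic_cost_uminus:
  assumes "quadratic_cost S F"
  shows "quadratic_cost S (\<lambda>p. - F p)"
  using assms unfolding quadratic_cost_def by auto

lemma quadratic_cost_diff:
  assumes "quadratic_cost S F" "quadratic_cost S F'"
  shows "quadratic_cost S (\<lambda>p. F p - F' p)"
  using quadratic_cost_add[OF assms(1) quadratic_cost_uminus[OF assms(2)]] by simp

lemma quadratic_cost_compose:
  assumes F: "quadratic_cost S F" and h: "continuous_on UNIV h"
    and c: "\<And>z. norm (h z) \<le> c * (1 + norm z)"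
  shows "quadratic_cost S (\<lambda>(s, z). F (s, h z))"
proof -
  obtain C where C: "\<And>s z. s \<in> S \<Longrightarrow> \<bar>F (s, z)\<bar> \<le> C * (1 + (norm z)\<^sup>2)"
    using F unfolding quadratic_cost_def by metis
  have "\<bar>F (s, h z)\<bar> \<le> \<bar>C\<bar> * (1 + 2 * c\<^sup>2) * (1 + (norm z)\<^sup>2)" if "s \<in> S" for s z
  proof -
    have "(norm (h z))\<^sup>2 \<le> (c * (1 + norm z))\<^sup>2"
      using c by (intro power_mono) auto
    also have "\<dots> = c\<^sup>2 * (1 + norm z)\<^sup>2"
      by (rule power_mult_distrib)
    also have "\<dots> \<le> c\<^sup>2 * (2 * (1 + (norm z)\<^sup>2))"
      using sum_squares_bound[of 1 "norm z"] by (intro mult_left_mono) (auto simp: power2_sum)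
    finally have "1 + (norm (h z))\<^sup>2 \<le> 1 + c\<^sup>2 * (2 * (1 + (norm z)\<^sup>2))"
      by simp
    also have "\<dots> \<le> (1 + 2 * c\<^sup>2) * (1 + (norm z)\<^sup>2)"
      by (simp add: algebra_simps)
    finally have "1 + (norm (h z))\<^sup>2 \<le> (1 + 2 * c\<^sup>2) * (1 + (norm z)\<^sup>2)" .
    then have "\<bar>C\<bar> * (1 + (norm (h z))\<^sup>2) \<le> \<bar>C\<bar> * ((1 + 2 * c\<^sup>2) * (1 + (norm z)\<^sup>2))"
      by (intro mult_left_mono) auto
    moreover have "\<bar>F (s, h z)\<bar> \<le> \<bar>C\<bar> * (1 + (norm (h z))\<^sup>2)"
      using C[OF that, of "h z"] by (smt (verit) mult_right_mono zero_le_power2)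
    ultimately show ?thesis
      by simp
  qed
  moreover have "(\<lambda>(s, z). F (s, h z)) \<in> borel_measurable (restrict_space borel (S \<times> UNIV))"
  proof -
    have "(\<lambda>p. (fst p, h (snd p))) \<in> borel_measurable borel"
      by (intro borel_measurable_continuous_onI continuous_intros continuous_on_compose2[OF h]) auto
    then have "(\<lambda>p. (fst p, h (snd p)))
        \<in> measurable (restrict_space borel (S \<times> UNIV)) (restrict_space borel (S \<times> UNIV))"
      by (intro measurable_restrict_space3) auto
    from measurable_compose[OF this, of F borel] F show ?thesis
      by (simp add: quadratic_cost_def case_prod_unfold)
  qed
  ultimately show ?thesis
    unfolding quadratic_cost_def by auto
qed

text \<open>Quadratic growth dominates the cost by second moments, which are bounded uniformly on a time
  interval of finite length.\<close>

lemma quadratic_cost_integrable: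
  fixes Z :: "real \<Rightarrow> 'w \<Rightarrow> 'z::euclidean_space"
  assumes F: "quadratic_cost S F" and Z: "L2_bounded M t T Z" and "{t..T} \<subseteq> S" and M: "prob_space M"
  shows quadratic_cost_integrable_at:
      "s \<in> {t..T} \<Longrightarrow> integrable M (\<lambda>\<omega>. F (s, Z s \<omega>))"
    and quadratic_cost_integrable_product:
      "integrable (restrict_space lborel {t..T} \<Otimes>\<^sub>M M) (\<lambda>(s, \<omega>). F (s, Z s \<omega>))"
proof -
  interpret prob_space M by fact
  let ?L = "restrict_space lborel {t..T}"
  obtain C where "\<And>s z. s \<in> S \<Longrightarrow> \<bar>F (s, z)\<bar> \<le> C * (1 + (norm z)\<^sup>2)"
    using F unfolding quadratic_cost_def by metis
  then have C: "\<bar>F (s, z)\<bar> \<le> \<bar>C\<bar> * (1 + (norm z)\<^sup>2)" if "s \<in> S" for s z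
    using that by (smt (verit) mult_right_mono zero_le_power2)
  obtain K where "K < \<infinity>" and K: "\<And>s. s \<in> {t..T} \<Longrightarrow> (\<integral>\<^sup>+ \<omega>. ennreal ((norm (Z s \<omega>))\<^sup>2) \<partial>M) \<le> K"
    using Z unfolding L2_bounded_def by metis
  let ?B = "ennreal \<bar>C\<bar> * (1 + K)"
  have B: "?B < \<infinity>"
    using \<open>K < \<infinity>\<close> by (simp add: ennreal_mult_less_top)
  have bound: "(\<integral>\<^sup>+ \<omega>. ennreal (norm (F (s, Z s \<omega>))) \<partial>M) \<le> ?B" if s: "s \<in> {t..T}" for s
  proof -
    have [measurable]: "Z s \<in> borel_measurable M"
      by (rule L2_bounded_measurable_at[OF Z s])
    have "(\<integral>\<^sup>+ \<omega>. ennreal (norm (F (s, Z s \<omega>))) \<partial>M) \<le>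
        (\<integral>\<^sup>+ \<omega>. ennreal \<bar>C\<bar> * (1 + ennreal ((norm (Z s \<omega>))\<^sup>2)) \<partial>M)"
    proof (rule nn_integral_mono)
      fix \<omega>
      have "ennreal (norm (F (s, Z s \<omega>))) \<le> ennreal (\<bar>C\<bar> * (1 + (norm (Z s \<omega>))\<^sup>2))"
        using C s \<open>{t..T} \<subseteq> S\<close> by (intro ennreal_leI) auto
      also have "\<dots> = ennreal \<bar>C\<bar> * (1 + ennreal ((norm (Z s \<omega>))\<^sup>2))"
        by (simp add: ennreal_mult' ennreal_plus)
      finally show "ennreal (norm (F (s, Z s \<omega>))) \<le> ennreal \<bar>C\<bar> * (1 + ennreal ((norm (Z s \<omega>))\<^sup>2))" .
    qed
    also have "\<dots> = ennreal \<bar>C\<bar> * (1 + (\<integral>\<^sup>+ \<omega>. ennreal ((norm (Z s \<omega>))\<^sup>2) \<partial>M))"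
      by (simp add: nn_integral_cmult nn_integral_add emeasure_space_1)
    also have "\<dots> \<le> ?B"
      by (intro mult_left_mono add_left_mono K s) simp
    finally show ?thesis .
  qed
  have "(\<lambda>p. (fst p, Z (fst p) (snd p))) \<in> borel_measurable (?L \<Otimes>\<^sub>M M)"
  proof (rule borel_measurable_Pair)
    have "(\<lambda>s. s) \<in> borel_measurable ?L"
      by (intro measurable_restrict_space1) simp
    from measurable_compose[OF measurable_fst this] show "fst \<in> borel_measurable (?L \<Otimes>\<^sub>M M)" .
    show "(\<lambda>p. Z (fst p) (snd p)) \<in> borel_measurable (?L \<Otimes>\<^sub>M M)"
      using Z by (simp add: L2_bounded_def case_prod_unfold)
  qed
  then have "(\<lambda>p. (fst p, Z (fst p) (snd p))) \<in> measurable (?L \<Otimes>\<^sub>M M) (restrict_space borel (S \<times> UNIV))"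
    using \<open>{t..T} \<subseteq> S\<close>
    by (intro measurable_restrict_space2) (auto simp: space_pair_measure space_restrict_space)
  from measurable_compose[OF this, of F borel] F
  have meas: "(\<lambda>(s, \<omega>). F (s, Z s \<omega>)) \<in> borel_measurable (?L \<Otimes>\<^sub>M M)"
    by (simp add: quadratic_cost_def case_prod_unfold)
  show "integrable M (\<lambda>\<omega>. F (s, Z s \<omega>))" if s: "s \<in> {t..T}"
  proof (rule integrableI_bounded)
    show "(\<lambda>\<omega>. F (s, Z s \<omega>)) \<in> borel_measurable M"
      using measurable_Pair2[OF meas, of s] s by (simp add: space_restrict_space)
    show "(\<integral>\<^sup>+ \<omega>. ennreal (norm (F (s, Z s \<omega>))) \<partial>M) < \<infinity>"
      using bound[OF s] B by (rule le_less_trans)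
  qed
  show "integrable (?L \<Otimes>\<^sub>M M) (\<lambda>(s, \<omega>). F (s, Z s \<omega>))"
  proof (rule integrableI_bounded[OF meas])
    have "(\<integral>\<^sup>+ p. ennreal (norm (case p of (s, \<omega>) \<Rightarrow> F (s, Z s \<omega>))) \<partial>(?L \<Otimes>\<^sub>M M)) =
        (\<integral>\<^sup>+ s. \<integral>\<^sup>+ \<omega>. ennreal (norm (F (s, Z s \<omega>))) \<partial>M \<partial>?L)"
      using meas by (subst nn_integral_fst[symmetric]) auto
    also have "\<dots> \<le> (\<integral>\<^sup>+ s. ?B \<partial>?L)"
      by (intro nn_integral_mono bound) (simp add: space_restrict_space)
    also have "\<dots> < \<infinity>"
      using B by (simp add: emeasure_restrict_space space_restrict_space ennreal_mult_less_top emeasure_lborel_Icc_eq)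
    finally show "(\<integral>\<^sup>+ p. ennreal (norm (case p of (s, \<omega>) \<Rightarrow> F (s, Z s \<omega>))) \<partial>(?L \<Otimes>\<^sub>M M)) < \<infinity>" .
  qed
qed

lemma quadratic_cost_path_integral:
  fixes Z :: "real \<Rightarrow> 'w \<Rightarrow> 'z::euclidean_space"
  assumes F: "quadratic_cost S F" and Z: "L2_bounded M t T Z" and S: "{t..T} \<subseteq> S" and M: "prob_space M"
  shows "AE \<omega> in M. set_integrable lborel {t..T} (\<lambda>s. F (s, Z s \<omega>))"
    and "integrable M (\<lambda>\<omega>. LBINT s:{t..T}. F (s, Z s \<omega>))"
proof -
  interpret prob_space M by fact
  let ?L = "restrict_space lborel {t..T}"
  interpret L: finite_measure ?L
    by (intro finite_measureI) (simp add: emeasure_restrict_space space_restrict_space emeasure_lborel_Icc_eq)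
  interpret pair_sigma_finite ?L M ..
  note int = quadratic_cost_integrable_product[OF assms]
  show "AE \<omega> in M. set_integrable lborel {t..T} (\<lambda>s. F (s, Z s \<omega>))"
    using AE_integrable_snd[OF int] by (simp add: set_integrable_def integrable_restrict_space)
  show "integrable M (\<lambda>\<omega>. LBINT s:{t..T}. F (s, Z s \<omega>))"
    using integrable_snd[OF int] by (simp add: set_lebesgue_integral_def integral_restrict_space)
qed

text \<open>The vector with the coordinates of the players in \<open>A\<close> taken from \<open>z\<close> and all others from \<open>z0\<close>, provided
  that the directions \<open>e k\<close> form an orthonormal basis.\<close>

definition replace_block ::
    "('k::finite \<Rightarrow> 'p) \<Rightarrow> ('k \<Rightarrow> 'z::real_inner) \<Rightarrow> 'z \<Rightarrow> 'p set \<Rightarrow> 'z \<Rightarrow> 'z" where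
  "replace_block own e z0 A z = z0 + (\<Sum>k\<in>{k. own k \<in> A}. ((z - z0) \<bullet> e k) *\<^sub>R e k)"

lemma replace_block_coordinate:
  assumes "\<And>k l. e k \<bullet> e l = of_bool (k = l)"
  shows "replace_block own e z0 A z \<bullet> e l = (if own l \<in> A then z \<bullet> e l else z0 \<bullet> e l)"
proof -
  have "replace_block own e z0 A z \<bullet> e l =
      z0 \<bullet> e l + (\<Sum>k\<in>{k. own k \<in> A}. if k = l then (z - z0) \<bullet> e l else 0)"
    unfolding replace_block_def inner_add_left inner_sum_left
    by (intro arg_cong2[where f = "(+)"] sum.cong refl) (simp add: assms)
  also have "\<dots> = (if own l \<in> A then z \<bullet> e l else z0 \<bullet> e l)"
    by (simp add: inner_diff_left)
  finally show ?thesis .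
qed

lemma norm_replace_block_le:
  assumes "\<And>k. e k \<bullet> e k = 1"
  shows "norm (replace_block own (e :: 'k::finite \<Rightarrow> _) z0 A z) \<le>
    (norm z0 + real CARD('k) * (1 + norm z0)) * (1 + norm z)"
proof -
  have e: "norm (e k) = 1" for k
    using assms[of k] by (simp add: norm_eq_sqrt_inner)
  have "norm (\<Sum>k\<in>{k. own k \<in> A}. ((z - z0) \<bullet> e k) *\<^sub>R e k) \<le> (\<Sum>k\<in>{k. own k \<in> A}. norm (z - z0))"
    using Cauchy_Schwarz_ineq2[of "z - z0" "e _"] by (intro sum_norm_le) (simp add: e)
  also have "\<dots> \<le> real CARD('k) * norm (z - z0)"
    by (simp add: card_mono mult_right_mono)
  also have "\<dots> \<le> real CARD('k) * (norm z + norm z0)"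
    by (intro mult_left_mono norm_triangle_ineq4) simp
  also have "\<dots> \<le> real CARD('k) * ((1 + norm z0) * (1 + norm z))"
    by (intro mult_left_mono) (simp_all add: algebra_simps)
  finally have "norm (replace_block own e z0 A z) \<le>
      norm z0 + real CARD('k) * ((1 + norm z0) * (1 + norm z))"
    unfolding replace_block_def using norm_triangle_ineq order_trans by (metis (no_types, lifting) add_left_mono)
  also have "\<dots> \<le> norm z0 * (1 + norm z) + real CARD('k) * ((1 + norm z0) * (1 + norm z))"
    by (simp add: algebra_simps)
  finally show ?thesis
    by (simp add: algebra_simps)
qed

text \<open>Adding the players to \<open>A\<close> one at a time, each step from \<open>replace_block own e z0 A z\<close> to
  \<open>replace_block own e z0 (insert j A) z\<close> changes only the block of player \<open>j\<close>, so by exactness the potential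
  changes by an increment of \<open>f j\<close>. The potential is thus a finite sum of compositions of the costs with
  affine maps in \<open>z\<close>, and such compositions stay measurable and of quadratic growth.\<close>

lemma quadratic_cost_line_potential:
  fixes f :: "'p::finite \<Rightarrow> real \<times> 'z::euclidean_space \<Rightarrow> real" and own :: "'k::finite \<Rightarrow> 'p"
  assumes quad: "\<And>i. quadratic_cost S (f i)"
    and f: "\<And>i s. s \<in> S \<Longrightarrow> twice_continuously_differentiable (\<lambda>z. f i (s, z))"
    and expand: "\<And>z. z = (\<Sum>k\<in>UNIV. (z \<bullet> e k) *\<^sub>R e k)"
    and orth: "\<And>k l. e k \<bullet> e l = of_bool (k = l)"
    and hess: "\<And>k l s p. s \<in> S \<Longrightarrow>
      partial_deriv (e k) (partial_deriv (e l) (\<lambda>z. f (own k) (s, z))) p =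
      partial_deriv (e k) (partial_deriv (e l) (\<lambda>z. f (own l) (s, z))) p"
  shows "quadratic_cost S (\<lambda>(s, z). line_potential own e (\<lambda>i z. f i (s, z)) z0 z)"
proof -
  let ?P = "\<lambda>s. line_potential own e (\<lambda>i z. f i (s, z)) z0"
  let ?R = "replace_block own e z0"
  have cost: "quadratic_cost S (\<lambda>(s, z). f i (s, ?R A z))" for i A
  proof (rule quadratic_cost_compose[OF quad])
    show "continuous_on UNIV (?R A)"
      unfolding replace_block_def by (intro continuous_intros)
    show "norm (?R A z) \<le> (norm z0 + real CARD('k) * (1 + norm z0)) * (1 + norm z)" for z
      by (rule norm_replace_block_le) (simp add: orth)
  qed
  have "quadratic_cost S (\<lambda>(s, z). ?P s (?R A z))" if "finite A" for A
    using that
  proof induction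
    case empty
    have "(\<lambda>p::real \<times> 'z. 0::real) \<in> borel_measurable (restrict_space borel (S \<times> UNIV))"
      by simp
    then show ?case
      by (auto simp: quadratic_cost_def replace_block_def line_potential_base case_prod_unfold
          intro!: exI[of _ 0])
  next
    case (insert j A)
    have "?P s (?R (insert j A) z) = ?P s (?R A z) + (f j (s, ?R (insert j A) z) - f j (s, ?R A z))"
      if "s \<in> S" for s z
    proof -
      have "?P s (?R (insert j A) z) - f j (s, ?R (insert j A) z) = ?P s (?R A z) - f j (s, ?R A z)"
        by (rule line_potential_exact[where f = "\<lambda>i z. f i (s, z)" and e = e and own = own and i = j])
          (use that f hess expand in \<open>auto simp: replace_block_coordinate[OF orth]\<close>)
      then show ?thesis by simp
    qed
    then show ?case
      using quadratic_cost_cong[OF quadratic_cost_add[OF insert.IH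
          quadratic_cost_diff[OF cost[of j "insert j A"] cost[of j A]]]]
      by (simp add: case_prod_unfold)
  qed
  from this[OF finite[of UNIV]] show ?thesis
    using expand[of "z - z0" for z, symmetric] by (simp add: replace_block_def)
qed


section \<open>Joint state and control of a distributed game\<close>

text \<open>Each coordinate belongs to exactly one player, so that its square is counted once on the right.\<close>

lemma norm_assemble_le:
  fixes own :: "'d::finite \<Rightarrow> 'p::finite"
  shows "(norm (assemble own y))\<^sup>2 \<le> (\<Sum>i\<in>UNIV. (norm (y i))\<^sup>2)"
proof -
  have norm2: "(norm v)\<^sup>2 = (\<Sum>k\<in>UNIV. (v $ k)\<^sup>2)" for v :: "real ^ 'd"
    unfolding power2_norm_eq_inner inner_vec_def by (simp add: power2_eq_square)
  have "(norm (assemble own y))\<^sup>2 = (\<Sum>k\<in>UNIV. (y (own k) $ k)\<^sup>2)"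
    by (simp add: norm2 assemble_def)
  also have "\<dots> = (\<Sum>i\<in>UNIV. \<Sum>k\<in>{k. own k = i}. (y (own k) $ k)\<^sup>2)"
    using sum.group[of "UNIV :: 'd set" "UNIV :: 'p set" own "\<lambda>k. (y (own k) $ k)\<^sup>2"] by simp
  also have "\<dots> \<le> (\<Sum>i\<in>UNIV. (norm (y i))\<^sup>2)"
    unfolding norm2 by (intro sum_mono) (auto intro!: sum_mono2)
  finally show ?thesis .
qed

lemma borel_measurable_assemble:
  fixes own :: "'d::finite \<Rightarrow> 'p::finite"
  assumes "\<And>i. (\<lambda>p. y p i) \<in> borel_measurable N"
  shows "(\<lambda>p. assemble own (y p)) \<in> borel_measurable N"
proof (subst borel_measurable_euclidean_space, rule ballI)
  fix b :: "real ^ 'd" assume "b \<in> Basis"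
  then obtain k where b: "b = axis k 1"
    by (auto simp: Basis_vec_def)
  have "(\<lambda>p. y p (own k) \<bullet> b) \<in> borel_measurable N"
    using assms[of "own k"] by measurable
  then show "(\<lambda>p. assemble own (y p) \<bullet> b) \<in> borel_measurable N"
    by (simp add: b inner_axis assemble_def)
qed

lemma weak_solution_L2_bounded:
  assumes "sq_int_weak_solution G i \<phi> t y X" "t \<le> horizon G"
  shows "L2_bounded (prob_sp G) t (horizon G) X"
proof -
  obtain \<F> where bm: "brownian_motion_wrt (prob_sp G) \<F> (horizon G) (bm G)"
    and adapted: "\<And>s. s \<in> {t..horizon G} \<Longrightarrow> X s \<in> borel_measurable (\<F> s)"
    and cont: "\<And>\<omega>. \<omega> \<in> space (prob_sp G) \<Longrightarrow> continuous_on {t..horizon G} (\<lambda>s. X s \<omega>)"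
    and sq: "(\<integral>\<^sup>+ \<omega>. (SUP s\<in>{t..horizon G}. ennreal ((norm (X s \<omega>))\<^sup>2)) \<partial>prob_sp G) < \<infinity>"
    using assms(1) unfolding sq_int_weak_solution_def Let_def by blast
  have "X s \<in> borel_measurable (prob_sp G)" if "s \<in> {t..horizon G}" for s
    using bm adapted[OF that] unfolding brownian_motion_wrt_def by (blast intro: measurable_from_subalg)
  then have "(\<lambda>(s, \<omega>). X s \<omega>) \<in> borel_measurable (restrict_space lborel {t..horizon G} \<Otimes>\<^sub>M prob_sp G)"
    using cont assms(2) by (rule continuous_process_jointly_measurable)
  moreover have "(\<integral>\<^sup>+ \<omega>. ennreal ((norm (X s \<omega>))\<^sup>2) \<partial>prob_sp G) \<le>
      (\<integral>\<^sup>+ \<omega>. (SUP s\<in>{t..horizon G}. ennreal ((norm (X s \<omega>))\<^sup>2)) \<partial>prob_sp G)"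
    if "s \<in> {t..horizon G}" for s
    using that by (intro nn_integral_mono SUP_upper)
  ultimately show ?thesis
    unfolding L2_bounded_def using sq by blast
qed

lemma weak_solution_in_block:
  assumes "sq_int_weak_solution G i \<phi> t y X" "s \<in> {t..horizon G}" "\<omega> \<in> space (prob_sp G)"
  shows "X s \<omega> \<in> block (own_x G) i"
proof -
  have "\<forall>\<omega>\<in>space (prob_sp G). continuous_on {t..horizon G} (\<lambda>s. X s \<omega>) \<and>
      (\<forall>s\<in>{t..horizon G}. X s \<omega> \<in> block (own_x G) i)"
    using assms(1) unfolding sq_int_weak_solution_def Let_def by (elim exE conjE)
  then show ?thesis
    using assms(2,3) by simp
qed

lemma policy_linear_growth:
  assumes "\<phi> \<in> policies G i"
  obtains C where "\<And>s y. s \<in> {0..horizon G} \<Longrightarrow> y \<in> block (own_x G) i \<Longrightarrow> norm (\<phi> (s, y)) \<le> C * (1 + norm y)"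
proof -
  have "bdd_above ((\<lambda>(t, y). norm (\<phi> (t, y)) / (1 + norm y)) ` ({0..horizon G} \<times> block (own_x G) i))"
    using assms unfolding policies_def Let_def mem_Collect_eq by (elim conjE)
  then obtain C where C: "\<And>v. v \<in> (\<lambda>(t, y). norm (\<phi> (t, y)) / (1 + norm y)) ` ({0..horizon G} \<times> block (own_x G) i) \<Longrightarrow> v \<le> C"
    unfolding bdd_above_def by blast
  have "norm (\<phi> (s, y)) \<le> C * (1 + norm y)" if "s \<in> {0..horizon G}" "y \<in> block (own_x G) i" for s y
  proof -
    have "norm (\<phi> (s, y)) / (1 + norm y) \<le> C"
      using that by (intro C) force
    moreover have "0 < 1 + norm y"
      by (simp add: add_pos_nonneg)
    ultimately show ?thesis
      by (simp add: divide_le_eq)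
  qed
  then show ?thesis
    by (rule that)
qed

lemma policy_process_measurable:
  assumes \<phi>: "\<phi> \<in> policies G i" and X: "L2_bounded M t (horizon G) X" and "0 \<le> t"
    and block: "\<And>s \<omega>. s \<in> {t..horizon G} \<Longrightarrow> \<omega> \<in> space M \<Longrightarrow> X s \<omega> \<in> block (own_x G) i"
  shows "(\<lambda>(s, \<omega>). \<phi> (s, X s \<omega>)) \<in> borel_measurable (restrict_space lborel {t..horizon G} \<Otimes>\<^sub>M M)"
proof -
  let ?L = "restrict_space lborel {t..horizon G}"
  let ?D = "{0..horizon G} \<times> block (own_x G) i"
  have "\<phi> \<in> borel_measurable (restrict_space borel ?D)"
    using \<phi> unfolding policies_def Let_def mem_Collect_eq by (elim conjE)
  moreover have "(\<lambda>p. (fst p, X (fst p) (snd p))) \<in> borel_measurable (?L \<Otimes>\<^sub>M M)"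
  proof (rule borel_measurable_Pair)
    have "(\<lambda>s. s) \<in> borel_measurable ?L"
      by (intro measurable_restrict_space1) simp
    from measurable_compose[OF measurable_fst this] show "fst \<in> borel_measurable (?L \<Otimes>\<^sub>M M)" .
    show "(\<lambda>p. X (fst p) (snd p)) \<in> borel_measurable (?L \<Otimes>\<^sub>M M)"
      using X by (simp add: L2_bounded_def case_prod_unfold)
  qed
  then have "(\<lambda>p. (fst p, X (fst p) (snd p))) \<in> measurable (?L \<Otimes>\<^sub>M M) (restrict_space borel ?D)"
    using block \<open>0 \<le> t\<close>
    by (intro measurable_restrict_space2) (auto simp: space_pair_measure space_restrict_space)
  ultimately have "(\<lambda>p. \<phi> (fst p, X (fst p) (snd p))) \<in> borel_measurable (?L \<Otimes>\<^sub>M M)"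
    by (rule measurable_compose[rotated])
  then show ?thesis
    by (simp add: case_prod_unfold)
qed

text \<open>By the linear growth of the policies, the squared norms of the joint state and control are dominated by
  the squared norms of the individual states.\<close>

lemma joint_process_L2_bounded:
  fixes G :: "('w, 'p::finite, 'd::finite, 'e::finite, 'm::finite) dist_game"
  assumes game: "distributed_game G" and t: "t \<in> {0..horizon G}"
    and \<phi>: "\<And>i. \<phi> i \<in> policies G i"
  shows "L2_bounded (prob_sp G) t (horizon G)
    (\<lambda>s \<omega>. (joint_state G t x \<phi> s \<omega>, joint_control G t x \<phi> s \<omega>))"
proof -
  let ?M = "prob_sp G" and ?T = "horizon G"
  let ?X = "\<lambda>i. state G i t (component (own_x G) i x) (\<phi> i)"
  have "component (own_x G) i x \<in> block (own_x G) i" for i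
    by (simp add: component_def block_def)
  then have sol: "sq_int_weak_solution G i (\<phi> i) t (component (own_x G) i x) (?X i)" for i
    using game t \<phi> unfolding distributed_game_def by blast
  have X: "L2_bounded ?M t ?T (?X i)" for i
    using weak_solution_L2_bounded[OF sol] t by simp
  note block = weak_solution_in_block[OF sol]
  have "\<exists>C. \<forall>s\<in>{0..?T}. \<forall>y\<in>block (own_x G) i. norm (\<phi> i (s, y)) \<le> C * (1 + norm y)" for i
    using policy_linear_growth[OF \<phi>[of i]] by metis
  then obtain C where C: "\<And>i s y. s \<in> {0..?T} \<Longrightarrow> y \<in> block (own_x G) i \<Longrightarrow>
      norm (\<phi> i (s, y)) \<le> C i * (1 + norm y)"
    by metis
  show ?thesis
  proof (rule L2_bounded_dominated[OF _ X])
    let ?N = "restrict_space lborel {t..?T} \<Otimes>\<^sub>M ?M"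
    have "(\<lambda>p. joint_state G t x \<phi> (fst p) (snd p)) \<in> borel_measurable ?N"
      unfolding joint_state_def using X by (intro borel_measurable_assemble) (simp add: L2_bounded_def case_prod_unfold)
    moreover have "(\<lambda>p. joint_control G t x \<phi> (fst p) (snd p)) \<in> borel_measurable ?N"
      unfolding joint_control_def
      using policy_process_measurable[OF \<phi> X _ block] t
      by (intro borel_measurable_assemble) (simp add: case_prod_unfold)
    ultimately show "(\<lambda>(s, \<omega>). (joint_state G t x \<phi> s \<omega>, joint_control G t x \<phi> s \<omega>)) \<in> borel_measurable ?N"
      unfolding case_prod_unfold by (rule borel_measurable_Pair)
    show "finite_measure ?M"
      using game by (simp add: distributed_game_def prob_space.finite_measure)
    fix s \<omega> assume s: "s \<in> {t..?T}" and \<omega>: "\<omega> \<in> space ?M"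
    let ?S = "\<Sum>i\<in>UNIV. (norm (?X i s \<omega>))\<^sup>2"
    have "(norm (joint_control G t x \<phi> s \<omega>))\<^sup>2 \<le> (\<Sum>i\<in>UNIV. (norm (\<phi> i (s, ?X i s \<omega>)))\<^sup>2)"
      unfolding joint_control_def by (rule norm_assemble_le)
    also have "\<dots> \<le> (\<Sum>i\<in>UNIV. 2 * (C i)\<^sup>2 * (1 + ?S))"
    proof (rule sum_mono)
      fix i
      have "(norm (\<phi> i (s, ?X i s \<omega>)))\<^sup>2 \<le> (C i * (1 + norm (?X i s \<omega>)))\<^sup>2"
        using C[of s "?X i s \<omega>" i] block[OF s \<omega>] s t by (intro power_mono) auto
      also have "\<dots> = (C i)\<^sup>2 * (1 + norm (?X i s \<omega>))\<^sup>2"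
        by (rule power_mult_distrib)
      also have "\<dots> \<le> (C i)\<^sup>2 * (2 * (1 + (norm (?X i s \<omega>))\<^sup>2))"
        using sum_squares_bound[of 1 "norm (?X i s \<omega>)"]
        by (intro mult_left_mono) (auto simp: power2_sum)
      also have "\<dots> \<le> (C i)\<^sup>2 * (2 * (1 + ?S))"
        using member_le_sum[of i UNIV "\<lambda>i. (norm (?X i s \<omega>))\<^sup>2"]
        by (intro mult_left_mono) auto
      finally show "(norm (\<phi> i (s, ?X i s \<omega>)))\<^sup>2 \<le> 2 * (C i)\<^sup>2 * (1 + ?S)"
        by (simp only: mult.assoc mult.left_commute)
    qed
    finally have "(norm (joint_control G t x \<phi> s \<omega>))\<^sup>2 \<le> (\<Sum>i\<in>UNIV. 2 * (C i)\<^sup>2) * (1 + ?S)"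
      by (simp add: sum_distrib_right)
    moreover have "(norm (joint_state G t x \<phi> s \<omega>))\<^sup>2 \<le> ?S"
      unfolding joint_state_def by (rule norm_assemble_le)
    ultimately show "(norm (joint_state G t x \<phi> s \<omega>, joint_control G t x \<phi> s \<omega>))\<^sup>2 \<le>
        (1 + (\<Sum>i\<in>UNIV. 2 * (C i)\<^sup>2)) * (1 + ?S)"
      by (simp add: norm_Pair distrib_right)
  qed
qed

text \<open>Fubini's theorem gives integrability of almost every path in time, so that the inner integral splits for
  almost every \<open>\<omega>\<close>.\<close>

lemma objective_diff:
  fixes G :: "('w, 'p::finite, 'd::finite, 'e::finite, 'm::finite) dist_game"
  assumes game: "distributed_game G" and t: "t \<in> {0..horizon G}"
    and \<phi>: "\<And>i. \<phi> i \<in> policies G i"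
    and F: "quadratic_cost {0..horizon G} F" and F': "quadratic_cost {0..horizon G} F'"
    and g: "quadratic_cost {0..horizon G} (\<lambda>(s, x). g x)"
    and g': "quadratic_cost {0..horizon G} (\<lambda>(s, x). g' x)"
  shows "objective G (\<lambda>p. F p - F' p) (\<lambda>x. g x - g' x) t x \<phi> =
    objective G F g t x \<phi> - objective G F' g' t x \<phi>"
proof -
  let ?M = "prob_sp G" and ?T = "horizon G"
  let ?Z = "\<lambda>s \<omega>. (joint_state G t x \<phi> s \<omega>, joint_control G t x \<phi> s \<omega>)"
  have M: "prob_space ?M"
    using game by (simp add: distributed_game_def)
  note Z = joint_process_L2_bounded[OF game t \<phi>, where x = x]
  have sub: "{t..?T} \<subseteq> {0..?T}"
    using t by auto
  have T: "?T \<in> {t..?T}"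
    using t by simp
  have terminal: "integrable ?M (\<lambda>\<omega>. h (joint_state G t x \<phi> ?T \<omega>))"
    if "quadratic_cost {0..?T} (\<lambda>(s, x). h x)" for h
  proof -
    have "quadratic_cost {0..?T} (\<lambda>(s, z :: (real ^ 'd) \<times> (real ^ 'e)). (\<lambda>(s, x). h x) (s, fst z))"
      by (rule quadratic_cost_compose[OF that, where c = 1])
        (auto intro: continuous_intros simp: norm_fst_le add_increasing)
    from quadratic_cost_integrable_at[OF this Z sub M T] show ?thesis
      by simp
  qed
  note running = quadratic_cost_path_integral[OF _ Z sub M]
  have "AE \<omega> in ?M.
      (LBINT s:{t..?T}. F (s, ?Z s \<omega>) - F' (s, ?Z s \<omega>)) + (g (joint_state G t x \<phi> ?T \<omega>) - g' (joint_state G t x \<phi> ?T \<omega>)) =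
      ((LBINT s:{t..?T}. F (s, ?Z s \<omega>)) + g (joint_state G t x \<phi> ?T \<omega>)) -
      ((LBINT s:{t..?T}. F' (s, ?Z s \<omega>)) + g' (joint_state G t x \<phi> ?T \<omega>))"
    using running(1)[OF F] running(1)[OF F'] by eventually_elim simp
  then have "objective G (\<lambda>p. F p - F' p) (\<lambda>x. g x - g' x) t x \<phi> =
      (\<integral>\<omega>. ((LBINT s:{t..?T}. F (s, ?Z s \<omega>)) + g (joint_state G t x \<phi> ?T \<omega>)) -
        ((LBINT s:{t..?T}. F' (s, ?Z s \<omega>)) + g' (joint_state G t x \<phi> ?T \<omega>)) \<partial>?M)"
    unfolding objective_def
    using running(2)[OF quadratic_cost_diff[OF F F']] running(2)[OF F] running(2)[OF F'] terminal[OF g] terminal[OF g']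
    by (intro integral_cong_AE) auto
  also have "\<dots> = objective G F g t x \<phi> - objective G F' g' t x \<phi>"
    unfolding objective_def
    using running(2)[OF F] running(2)[OF F'] terminal[OF g] terminal[OF g']
    by (intro Bochner_Integration.integral_diff) auto
  finally show ?thesis .
qed

section \<open>State and action coordinates\<close>

text \<open>Labelling state and action coordinates by one sum type turns the four conditions on Hessian blocks into
  the single symmetry condition of \<open>line_potential_exact\<close>.\<close>

definition xa_dir :: "'d::finite + 'e::finite \<Rightarrow> (real ^ 'd) \<times> (real ^ 'e)" where
  "xa_dir = case_sum xa_dir_x xa_dir_a"

lemma sum_UNIV_Plus:
  "(\<Sum>k\<in>(UNIV :: ('d::finite + 'e::finite) set). h k) = (\<Sum>k\<in>UNIV. h (Inl k)) + (\<Sum>l\<in>UNIV. h (Inr l))"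
  unfolding UNIV_Plus_UNIV[symmetric] by (subst sum.Plus) auto

lemma inner_xa_dir:
  "z \<bullet> xa_dir (Inl k) = fst z $ k" "z \<bullet> xa_dir (Inr l) = snd z $ l"
  by (cases z; simp add: xa_dir_def xa_dir_x_def xa_dir_a_def inner_axis)+

lemma xa_dir_expand: "z = (\<Sum>k\<in>UNIV. (z \<bullet> xa_dir k) *\<^sub>R xa_dir k)"
proof (rule prod_eqI)
  have axes: "(\<Sum>k\<in>UNIV. (v $ k) *\<^sub>R axis k (1::real)) = v" for v :: "real ^ 'n::finite"
    using basis_expansion[of v] by (simp add: scalar_mult_eq_scaleR)
  show "fst z = fst (\<Sum>k\<in>UNIV. (z \<bullet> xa_dir k) *\<^sub>R xa_dir k)"
    by (simp add: sum_UNIV_Plus inner_xa_dir fst_sum axes) (simp add: xa_dir_def xa_dir_x_def xa_dir_a_def axes)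
  show "snd z = snd (\<Sum>k\<in>UNIV. (z \<bullet> xa_dir k) *\<^sub>R xa_dir k)"
    by (simp add: sum_UNIV_Plus inner_xa_dir snd_sum axes) (simp add: xa_dir_def xa_dir_x_def xa_dir_a_def axes)
qed

lemma xa_dir_orthonormal: "xa_dir k \<bullet> xa_dir l = of_bool (k = l)"
  by (cases k; cases l)
    (simp_all add: xa_dir_def xa_dir_x_def xa_dir_a_def inner_axis_axis)

lemma x_dir_expand: "z = (\<Sum>k\<in>UNIV. (z \<bullet> x_dir k) *\<^sub>R x_dir k)"
  using basis_expansion[of z] by (simp add: scalar_mult_eq_scaleR x_dir_def inner_axis)

lemma x_dir_orthonormal: "x_dir k \<bullet> x_dir l = of_bool (k = l)"
  by (simp add: x_dir_def inner_axis_axis)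

lemma player_grad_inner_component:
  "player_grad own e i h p \<bullet> component own i v = (\<Sum>k\<in>{k. own k = i}. partial_deriv (e k) h p * v $ k)"
  by (simp add: player_grad_def component_def inner_vec_def sum.If_cases if_distrib cong: if_cong)

lemma potential_running_eq_line_potential:
  "potential_running G x0 a0 (t, z) =
    line_potential (case_sum (own_x G) (own_a G)) xa_dir (\<lambda>i q. running G i (t, q)) (x0, a0) z"
proof -
  obtain x a where z: "z = (x, a)"
    by (cases z)
  have split: "(\<Sum>k\<in>{k. case_sum (own_x G) (own_a G) k = i}. h k) =
      (\<Sum>k\<in>{k. own_x G k = i}. h (Inl k)) + (\<Sum>l\<in>{l. own_a G l = i}. h (Inr l))" for i and h :: "_ \<Rightarrow> real"
  proof -
    have "{k. case_sum (own_x G) (own_a G) k = i} = {k. own_x G k = i} <+> {l. own_a G l = i}"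
    proof (rule set_eqI)
      show "k \<in> {k. case_sum (own_x G) (own_a G) k = i} \<longleftrightarrow> k \<in> {k. own_x G k = i} <+> {l. own_a G l = i}" for k
        by (cases k) auto
    qed
    then show ?thesis
      by (simp add: sum.Plus)
  qed
  show ?thesis
    unfolding potential_running_def line_potential_def z Let_def split
    by (simp add: player_grad_inner_component inner_xa_dir) (simp add: xa_dir_def)
qed

lemma potential_terminal_eq_line_potential:
  "potential_terminal G x0 x = line_potential (own_x G) x_dir (terminal G) x0 x"
  unfolding potential_terminal_def line_potential_def
  by (simp add: player_grad_inner_component x_dir_def inner_axis)

lemma running_quadratic_cost:
  assumes "distributed_game G"
  shows "quadratic_cost {0..horizon G} (running G i)"
proof -
  have both: "\<forall>i. running G i \<in> borel_measurable (restrict_space borel ({0..horizon G} \<times> UNIV \<times> UNIV)) \<and>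
      bdd_above ((\<lambda>(t, x, a). \<bar>running G i (t, x, a)\<bar> / (1 + (norm x)\<^sup>2 + (norm a)\<^sup>2)) `
        ({0..horizon G} \<times> UNIV \<times> UNIV))"
    using assms unfolding distributed_game_def by (elim conjE)
  note meas = conjunct1[OF spec[OF both, of i]] and bdd = conjunct2[OF spec[OF both, of i]]
  obtain C where C: "\<forall>v\<in>(\<lambda>(t, x, a). \<bar>running G i (t, x, a)\<bar> / (1 + (norm x)\<^sup>2 + (norm a)\<^sup>2)) `
      ({0..horizon G} \<times> UNIV \<times> UNIV). v \<le> C"
    using bdd unfolding bdd_above_def by (elim exE)
  have "\<bar>running G i (s, z)\<bar> \<le> C * (1 + (norm z)\<^sup>2)" if "s \<in> {0..horizon G}" for s z
  proof -
    obtain x a where z: "z = (x, a)"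
      by (cases z)
    have "\<bar>running G i (s, x, a)\<bar> / (1 + (norm x)\<^sup>2 + (norm a)\<^sup>2) \<le> C"
      using that by (intro bspec[OF C] image_eqI[of _ _ "(s, x, a)"]) auto
    moreover have "0 < 1 + (norm x)\<^sup>2 + (norm a)\<^sup>2"
      by (intro add_pos_nonneg) auto
    ultimately show ?thesis
      by (simp add: z norm_Pair divide_le_eq add.assoc)
  qed
  then show ?thesis
    using meas unfolding quadratic_cost_def UNIV_Times_UNIV by blast
qed

lemma terminal_quadratic_cost:
  assumes "distributed_game G"
  shows "quadratic_cost S (\<lambda>(s, x). terminal G i x)"
proof -
  have both: "\<forall>i. terminal G i \<in> borel_measurable borel \<and>
      bdd_above (range (\<lambda>x. \<bar>terminal G i x\<bar> / (1 + (norm x)\<^sup>2)))"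
    using assms unfolding distributed_game_def by (elim conjE)
  note meas = conjunct1[OF spec[OF both, of i]] and bdd = conjunct2[OF spec[OF both, of i]]
  obtain C where "\<forall>v\<in>range (\<lambda>x. \<bar>terminal G i x\<bar> / (1 + (norm x)\<^sup>2)). v \<le> C"
    using bdd unfolding bdd_above_def by (elim exE)
  then have C: "\<bar>terminal G i x\<bar> / (1 + (norm x)\<^sup>2) \<le> C" for x
    by simp
  have "\<bar>terminal G i x\<bar> \<le> C * (1 + (norm x)\<^sup>2)" for x
    using C[of x] by (simp add: divide_le_eq add_pos_nonneg)
  moreover have "(\<lambda>p. terminal G i (snd p)) \<in> borel_measurable (restrict_space borel (S \<times> UNIV))"
    using meas
    by (intro measurable_restrict_space1 measurable_compose[OF _ meas] borel_measurable_continuous_onI continuous_intros)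
  ultimately show ?thesis
    by (auto simp: quadratic_cost_def case_prod_unfold)
qed


section \<open>The potential function\<close>

theorem theorem3p2:
  fixes G :: "('w, 'p::finite, 'd::finite, 'e::finite, 'm::finite) dist_game"
    and x0 :: "real ^ 'd" and a0 :: "real ^ 'e"
  assumes game: "distributed_game G"
    and C2: "\<And>i t. t \<in> {0..horizon G} \<Longrightarrow>
      twice_continuously_differentiable (\<lambda>(x, a). (running G i (t, x, a), terminal G i x))"
    and hess_xx: "\<And>i j t p. t \<in> {0..horizon G} \<Longrightarrow>
      player_hess (own_x G) xa_dir_x i (own_x G) xa_dir_x j (\<lambda>q. running G i (t, q)) p =
      player_hess (own_x G) xa_dir_x i (own_x G) xa_dir_x j (\<lambda>q. running G j (t, q)) p"
    and hess_ax: "\<And>i j t p. t \<in> {0..horizon G} \<Longrightarrow>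
      player_hess (own_a G) xa_dir_a i (own_x G) xa_dir_x j (\<lambda>q. running G i (t, q)) p =
      player_hess (own_a G) xa_dir_a i (own_x G) xa_dir_x j (\<lambda>q. running G j (t, q)) p"
    and hess_xa: "\<And>i j t p. t \<in> {0..horizon G} \<Longrightarrow>
      player_hess (own_x G) xa_dir_x i (own_a G) xa_dir_a j (\<lambda>q. running G i (t, q)) p =
      player_hess (own_x G) xa_dir_x i (own_a G) xa_dir_a j (\<lambda>q. running G j (t, q)) p"
    and hess_aa: "\<And>i j t p. t \<in> {0..horizon G} \<Longrightarrow>
      player_hess (own_a G) xa_dir_a i (own_a G) xa_dir_a j (\<lambda>q. running G i (t, q)) p =
      player_hess (own_a G) xa_dir_a i (own_a G) xa_dir_a j (\<lambda>q. running G j (t, q)) p"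
    and hess_g: "\<And>i j x.
      player_hess (own_x G) x_dir i (own_x G) x_dir j (terminal G i) x =
      player_hess (own_x G) x_dir i (own_x G) x_dir j (terminal G j) x"
    and growth: "\<And>i. bdd_above
      ((\<lambda>(t, x, a).
          (norm (player_grad (own_x G) xa_dir_x i (\<lambda>q. running G i (t, q)) (x, a),
                 player_grad (own_a G) xa_dir_a i (\<lambda>q. running G i (t, q)) (x, a)) +
           norm (player_grad (own_x G) x_dir i (terminal G i) x)) /
          (1 + norm x + norm a)) ` ({0..horizon G} \<times> UNIV \<times> UNIV))"
  shows "markov_potential_game_with G
    (objective G (potential_running G x0 a0) (potential_terminal G x0))"
proof -
  let ?T = "horizon G"
  let ?own = "case_sum (own_x G) (own_a G)"
  have pos: "0 < ?T"
    using game by (simp add: distributed_game_def)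
  have C2_running: "twice_continuously_differentiable (\<lambda>q. running G i (t, q))" if "t \<in> {0..?T}" for i t
    using twice_continuously_differentiable_linear_compose[OF C2[OF that, of i] bounded_linear_fst bounded_linear_ident]
    by (simp add: case_prod_unfold)
  have C2_terminal: "twice_continuously_differentiable (terminal G i)" for i
  proof -
    have "bounded_linear (\<lambda>x :: real ^ 'd. (x, 0 :: real ^ 'e))"
      by (intro bounded_linear_Pair bounded_linear_ident bounded_linear_zero)
    from twice_continuously_differentiable_linear_compose[OF C2[of 0 i] bounded_linear_snd this] show ?thesis
      using pos by simp
  qed
  have hess_running: "partial_deriv (xa_dir k) (partial_deriv (xa_dir l) (\<lambda>q. running G (?own k) (t, q))) p =
      partial_deriv (xa_dir k) (partial_deriv (xa_dir l) (\<lambda>q. running G (?own l) (t, q))) p"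
    if t: "t \<in> {0..?T}" for k l t p
  proof -
    note entries = fun_cong[OF arg_cong[where f = vec_nth, OF fun_cong[OF arg_cong[where f = vec_nth]]]]
    show ?thesis
    proof (cases k; cases l)
      fix k' l' assume "k = Inl k'" "l = Inl l'"
      then show ?thesis
        using entries[OF hess_xx[OF t, of "own_x G k'" "own_x G l'" p], of k' l']
        by (simp add: player_hess_def xa_dir_def)
    next
      fix k' l' assume "k = Inl k'" "l = Inr l'"
      then show ?thesis
        using entries[OF hess_xa[OF t, of "own_x G k'" "own_a G l'" p], of k' l']
        by (simp add: player_hess_def xa_dir_def)
    next
      fix k' l' assume "k = Inr k'" "l = Inl l'"
      then show ?thesis
        using entries[OF hess_ax[OF t, of "own_a G k'" "own_x G l'" p], of k' l']
        by (simp add: player_hess_def xa_dir_def)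
    next
      fix k' l' assume "k = Inr k'" "l = Inr l'"
      then show ?thesis
        using entries[OF hess_aa[OF t, of "own_a G k'" "own_a G l'" p], of k' l']
        by (simp add: player_hess_def xa_dir_def)
    qed
  qed
  have hess_terminal: "partial_deriv (x_dir k) (partial_deriv (x_dir l) (terminal G (own_x G k))) p =
      partial_deriv (x_dir k) (partial_deriv (x_dir l) (terminal G (own_x G l))) p" for k l p
    using fun_cong[OF arg_cong[where f = vec_nth, OF fun_cong[OF arg_cong[where f = vec_nth,
      OF hess_g[of "own_x G k" "own_x G l" p]]]], of k l]
    by (simp add: player_hess_def)
  have quad_running: "quadratic_cost {0..?T} (potential_running G x0 a0)"
  proof (rule quadratic_cost_cong)
    show "quadratic_cost {0..?T} (\<lambda>(s, z). line_potential ?own xa_dir (\<lambda>i z. running G i (s, z)) (x0, a0) z)"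
      by (rule quadratic_cost_line_potential)
        (rule running_quadratic_cost game C2_running xa_dir_expand xa_dir_orthonormal hess_running; assumption?)+
  qed (simp add: potential_running_eq_line_potential)
  have quad_terminal: "quadratic_cost {0..?T} (\<lambda>(s, x). potential_terminal G x0 x)"
  proof -
    have "quadratic_cost {0..?T}
        (\<lambda>(s, x). line_potential (own_x G) x_dir (\<lambda>i z. (\<lambda>(s, x). terminal G i x) (s, z)) x0 x)"
    proof (rule quadratic_cost_line_potential)
      show "quadratic_cost {0..?T} (\<lambda>(s, x). terminal G i x)" for i
        by (rule terminal_quadratic_cost[OF game])
      show "twice_continuously_differentiable (\<lambda>z. (\<lambda>(s, x). terminal G i x) (s, z))" for i and s :: real
        by (simp add: C2_terminal)
      show "partial_deriv (x_dir k) (partial_deriv (x_dir l) (\<lambda>z. (\<lambda>(s, x). terminal G (own_x G k) x) (s, z))) p =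
          partial_deriv (x_dir k) (partial_deriv (x_dir l) (\<lambda>z. (\<lambda>(s, x). terminal G (own_x G l) x) (s, z))) p"
        for k l p and s :: real
        using hess_terminal by simp
    qed (rule x_dir_expand x_dir_orthonormal)+
    then show ?thesis
      by (simp add: potential_terminal_eq_line_potential)
  qed
  show ?thesis
    unfolding markov_potential_game_with_def
  proof (intro ballI allI impI)
    fix t x i \<phi>\<^sub>i \<phi>\<^sub>i' \<phi>
    assume t: "t \<in> {0..?T}" and \<phi>\<^sub>i: "\<phi>\<^sub>i \<in> policies G i" and \<phi>\<^sub>i': "\<phi>\<^sub>i' \<in> policies G i"
      and others: "\<forall>j. j \<noteq> i \<longrightarrow> \<phi> j \<in> policies G j"
    let ?\<phi> = "\<phi>(i := \<phi>\<^sub>i)" and ?\<phi>' = "\<phi>(i := \<phi>\<^sub>i')"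
    let ?P = "objective G (potential_running G x0 a0) (potential_terminal G x0) t x"
    let ?D = "objective G (\<lambda>p. potential_running G x0 a0 p - running G i p)
      (\<lambda>x. potential_terminal G x0 x - terminal G i x) t x"
    \<comment> \<open>Subtracting the cost of player \<open>i\<close> from the potential leaves an objective that ignores the deviation.\<close>
    have split: "?D \<psi> = ?P \<psi> - value_function G i t x \<psi>" if "\<And>j. \<psi> j \<in> policies G j" for \<psi>
      unfolding value_function_def
      by (rule objective_diff[OF game t that quad_running running_quadratic_cost[OF game]
          quad_terminal terminal_quadratic_cost[OF game]])
    have running: "potential_running G x0 a0 (s, z') - running G i (s, z') =
        potential_running G x0 a0 (s, z) - running G i (s, z)"
      if "s \<in> {t..?T}" and "\<And>k. ?own k \<noteq> i \<Longrightarrow> z \<bullet> xa_dir k = z' \<bullet> xa_dir k" for s z z'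
      unfolding potential_running_eq_line_potential
      by (rule line_potential_exact[where f = "\<lambda>i q. running G i (s, q)" and e = xa_dir and own = ?own,
            OF C2_running xa_dir_expand hess_running that(2)])
        (use that(1) t in auto)
    have terminal: "potential_terminal G x0 y' - terminal G i y' = potential_terminal G x0 y - terminal G i y"
      if "\<And>k. own_x G k \<noteq> i \<Longrightarrow> y \<bullet> x_dir k = y' \<bullet> x_dir k" for y y'
      unfolding potential_terminal_eq_line_potential
      by (rule line_potential_exact[where f = "terminal G" and e = x_dir and own = "own_x G",
            OF C2_terminal x_dir_expand hess_terminal that])
    have state: "joint_state G t x ?\<phi> s \<omega> $ k = joint_state G t x ?\<phi>' s \<omega> $ k" if "own_x G k \<noteq> i" for s \<omega> k
      using that by (simp add: joint_state_def assemble_def)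
    have control: "joint_control G t x ?\<phi> s \<omega> $ k = joint_control G t x ?\<phi>' s \<omega> $ k" if "own_a G k \<noteq> i" for s \<omega> k
      using that by (simp add: joint_control_def assemble_def)
    have "?D ?\<phi>' = ?D ?\<phi>"
      unfolding objective_def
    proof (intro Bochner_Integration.integral_cong refl arg_cong2[where f = "(+)"] set_lebesgue_integral_cong allI impI)
      fix s \<omega> assume s: "s \<in> {t..?T}"
      show "potential_running G x0 a0 (s, joint_state G t x ?\<phi>' s \<omega>, joint_control G t x ?\<phi>' s \<omega>) -
          running G i (s, joint_state G t x ?\<phi>' s \<omega>, joint_control G t x ?\<phi>' s \<omega>) =
        potential_running G x0 a0 (s, joint_state G t x ?\<phi> s \<omega>, joint_control G t x ?\<phi> s \<omega>) -
          running G i (s, joint_state G t x ?\<phi> s \<omega>, joint_control G t x ?\<phi> s \<omega>)"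
        by (rule running[OF s]) (auto simp: inner_xa_dir state control split: sum.splits)
    next
      fix \<omega>
      show "potential_terminal G x0 (joint_state G t x ?\<phi>' ?T \<omega>) - terminal G i (joint_state G t x ?\<phi>' ?T \<omega>) =
          potential_terminal G x0 (joint_state G t x ?\<phi> ?T \<omega>) - terminal G i (joint_state G t x ?\<phi> ?T \<omega>)"
        by (rule terminal) (simp add: x_dir_def inner_axis state)
    qed simp
    moreover have "?\<phi> j \<in> policies G j" "?\<phi>' j \<in> policies G j" for j
      using \<phi>\<^sub>i \<phi>\<^sub>i' others by auto
    ultimately show "?P ?\<phi>' - ?P ?\<phi> = value_function G i t x ?\<phi>' - value_function G i t x ?\<phi>"
      using split[of ?\<phi>] split[of ?\<phi>'] by simp
  qed
qed

end
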